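(* Let $R$ be an s-unital purely infinite exchange ring. Then the matrix ring $M_n(R)$ is properly purely infinite for every $n\in\mathbb{N}$.
   Context: Rings are associative and not necessarily unital. A ring $R$ is s-unital if for each $x\in R$ there exist $u,v\in R$ with $ux=xv=x$. A (possibly nonunital) ring $R$ is an exchange ring if for each $x\in R$ there exist an idempotent $e\in R$ and elements $r,s\in R$ such that $e=xr=x+s-xs$. For $a\in R$, $RaR$ denotes the set of finite sums $\sum_i r_ias_i$ with $r_i,s_i\in R$. A ring $R$ is purely infinite if (i) no quotient of $R$ is a division ring, and (ii) whenever $a\in R$ and $b\in RaR$, there exist $x,y\in R$ with $b=xay$. An element $a\in R$ is properly infinite if $a\neq 0$ and there exist $\alpha_1,\alpha_2,\beta_1,\beta_2\in R$ with $\alpha_i a\beta_j=\delta_{ij}a$ for all $i,j\in\{1,2\}$. A ring is properly purely infinite if every nonzero element of it is properly infinite. *)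

theory Defs
  imports "Jordan_Normal_Form.Matrix" "HOL-Algebra.QuotRing"
begin

text \<open>
  Rings are associative but need not have an identity, whereas the locale \<^locale>\<open>ring\<close> of
  HOL-Algebra is unital.  We keep its record type, but no ring property below depends on the
  \<^const>\<open>one\<close> field, which carries an arbitrary value and is not required to lie in the carrier.
\<close>

locale nonunital_ring = abelian_group R for R (structure) +
  assumes mult_closed: "\<lbrakk>x \<in> carrier R; y \<in> carrier R\<rbrakk> \<Longrightarrow> x \<otimes> y \<in> carrier R"
    and mult_assoc: "\<lbrakk>x \<in> carrier R; y \<in> carrier R; z \<in> carrier R\<rbrakk>
      \<Longrightarrow> (x \<otimes> y) \<otimes> z = x \<otimes> (y \<otimes> z)"
    and left_distrib: "\<lbrakk>x \<in> carrier R; y \<in> carrier R; z \<in> carrier R\<rbrakk>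
      \<Longrightarrow> (x \<oplus> y) \<otimes> z = x \<otimes> z \<oplus> y \<otimes> z"
    and right_distrib: "\<lbrakk>x \<in> carrier R; y \<in> carrier R; z \<in> carrier R\<rbrakk>
      \<Longrightarrow> z \<otimes> (x \<oplus> y) = z \<otimes> x \<oplus> z \<otimes> y"

definition s_unital :: "('a, 'm) ring_scheme \<Rightarrow> bool" where
  "s_unital R \<longleftrightarrow> (\<forall>x\<in>carrier R. \<exists>u\<in>carrier R. \<exists>v\<in>carrier R.
     u \<otimes>\<^bsub>R\<^esub> x = x \<and> x \<otimes>\<^bsub>R\<^esub> v = x)"

definition exchange_ring :: "('a, 'm) ring_scheme \<Rightarrow> bool" where
  "exchange_ring R \<longleftrightarrow> (\<forall>x\<in>carrier R. \<exists>e\<in>carrier R. \<exists>r\<in>carrier R. \<exists>s\<in>carrier R.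
     e \<otimes>\<^bsub>R\<^esub> e = e \<and> e = x \<otimes>\<^bsub>R\<^esub> r \<and> e = x \<oplus>\<^bsub>R\<^esub> s \<ominus>\<^bsub>R\<^esub> x \<otimes>\<^bsub>R\<^esub> s)"

text \<open>The library locale \<^locale>\<open>ideal\<close> presupposes a unital ring.\<close>

definition two_sided_ideal :: "'a set \<Rightarrow> ('a, 'm) ring_scheme \<Rightarrow> bool" where
  "two_sided_ideal I R \<longleftrightarrow> additive_subgroup I R \<and>
     (\<forall>a\<in>I. \<forall>x\<in>carrier R. x \<otimes>\<^bsub>R\<^esub> a \<in> I \<and> a \<otimes>\<^bsub>R\<^esub> x \<in> I)"

text \<open>The identity of a division ring is asserted to exist, since the \<^const>\<open>one\<close> field is
  meaningless here.\<close>

definition is_division_ring :: "('a, 'm) ring_scheme \<Rightarrow> bool" where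
  "is_division_ring D \<longleftrightarrow> nonunital_ring D \<and>
     (\<exists>e\<in>carrier D. e \<noteq> \<zero>\<^bsub>D\<^esub> \<and>
        (\<forall>x\<in>carrier D. e \<otimes>\<^bsub>D\<^esub> x = x \<and> x \<otimes>\<^bsub>D\<^esub> e = x) \<and>
        (\<forall>x\<in>carrier D. x \<noteq> \<zero>\<^bsub>D\<^esub> \<longrightarrow>
           (\<exists>y\<in>carrier D. x \<otimes>\<^bsub>D\<^esub> y = e \<and> y \<otimes>\<^bsub>D\<^esub> x = e)))"

text \<open>The set \<open>RaR\<close> of finite sums \<open>\<Sum>\<^sub>i r\<^sub>i a s\<^sub>i\<close>.\<close>

definition sandwich_sums :: "('a, 'm) ring_scheme \<Rightarrow> 'a \<Rightarrow> 'a set" where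
  "sandwich_sums R a = {(\<Oplus>\<^bsub>R\<^esub>i\<in>{..<k}. r i \<otimes>\<^bsub>R\<^esub> a \<otimes>\<^bsub>R\<^esub> s i) | (k::nat) r s.
     r \<in> {..<k} \<rightarrow> carrier R \<and> s \<in> {..<k} \<rightarrow> carrier R}"

definition purely_infinite :: "('a, 'm) ring_scheme \<Rightarrow> bool" where
  "purely_infinite R \<longleftrightarrow>
     (\<forall>I. two_sided_ideal I R \<longrightarrow> \<not> is_division_ring (R Quot I)) \<and>
     (\<forall>a\<in>carrier R. \<forall>b\<in>sandwich_sums R a.
        \<exists>x\<in>carrier R. \<exists>y\<in>carrier R. b = x \<otimes>\<^bsub>R\<^esub> a \<otimes>\<^bsub>R\<^esub> y)"

definition properly_infinite :: "('a, 'm) ring_scheme \<Rightarrow> 'a \<Rightarrow> bool" where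
  "properly_infinite R a \<longleftrightarrow> a \<in> carrier R \<and> a \<noteq> \<zero>\<^bsub>R\<^esub> \<and>
     (\<exists>\<alpha> \<beta>. \<alpha> \<in> {1, 2::nat} \<rightarrow> carrier R \<and> \<beta> \<in> {1, 2::nat} \<rightarrow> carrier R \<and>
        (\<forall>i\<in>{1, 2}. \<forall>j\<in>{1, 2}.
           \<alpha> i \<otimes>\<^bsub>R\<^esub> a \<otimes>\<^bsub>R\<^esub> \<beta> j = (if i = j then a else \<zero>\<^bsub>R\<^esub>)))"

definition properly_purely_infinite :: "('a, 'm) ring_scheme \<Rightarrow> bool" where
  "properly_purely_infinite R \<longleftrightarrow>
     (\<forall>a\<in>carrier R. a \<noteq> \<zero>\<^bsub>R\<^esub> \<longrightarrow> properly_infinite R a)"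

text \<open>
  The library operations on \<^typ>\<open>'a mat\<close> use the type-class arithmetic of the entries, so for
  entries in a ring with explicit carrier the operations are spelled out.  For \<open>n = 0\<close> this is the
  zero ring.
\<close>

definition matrix_ring :: "('a, 'm) ring_scheme \<Rightarrow> nat \<Rightarrow> 'a mat ring" where
  "matrix_ring R n = \<lparr>
     carrier = {A \<in> carrier_mat n n. \<forall>i<n. \<forall>j<n. A $$ (i, j) \<in> carrier R},
     mult = (\<lambda>A B. mat n n (\<lambda>(i, j). \<Oplus>\<^bsub>R\<^esub>k\<in>{..<n}. A $$ (i, k) \<otimes>\<^bsub>R\<^esub> B $$ (k, j))),
     one = mat n n (\<lambda>(i, j). if i = j then \<one>\<^bsub>R\<^esub> else \<zero>\<^bsub>R\<^esub>),
     zero = mat n n (\<lambda>(i, j). \<zero>\<^bsub>R\<^esub>),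
     add = (\<lambda>A B. mat n n (\<lambda>(i, j). A $$ (i, j) \<oplus>\<^bsub>R\<^esub> B $$ (i, j)))\<rparr>"

lemma (in ring) ring_is_nonunital_ring: "nonunital_ring R"
  by unfold_locales (auto simp: m_assoc l_distr r_distr)

context nonunital_ring
begin

lemma zero_mult: "x \<in> carrier R \<Longrightarrow> \<zero> \<otimes> x = \<zero>"
  by (metis left_distrib add.l_cancel_one' mult_closed zero_closed r_zero)

lemma mult_zero: "x \<in> carrier R \<Longrightarrow> x \<otimes> \<zero> = \<zero>"
  by (metis right_distrib add.l_cancel_one' mult_closed zero_closed r_zero)

lemma finsum_left_mult:
  "finite A \<Longrightarrow> f \<in> A \<rightarrow> carrier R \<Longrightarrow> x \<in> carrier R \<Longrightarrow> x \<otimes> finsum R f A = (\<Oplus>i\<in>A. x \<otimes> f i)"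
  by (induction A rule: finite_induct) (auto simp: mult_zero right_distrib mult_closed Pi_def finsum_insert intro!: finsum_closed)

lemma finsum_right_mult:
  "finite A \<Longrightarrow> f \<in> A \<rightarrow> carrier R \<Longrightarrow> x \<in> carrier R \<Longrightarrow> finsum R f A \<otimes> x = (\<Oplus>i\<in>A. f i \<otimes> x)"
  by (induction A rule: finite_induct) (auto simp: zero_mult left_distrib mult_closed Pi_def finsum_insert intro!: finsum_closed)

lemma finsum_swap:
  "finite A \<Longrightarrow> finite B \<Longrightarrow> (\<And>i j. i \<in> A \<Longrightarrow> j \<in> B \<Longrightarrow> f i j \<in> carrier R)
   \<Longrightarrow> (\<Oplus>i\<in>A. \<Oplus>j\<in>B. f i j) = (\<Oplus>j\<in>B. \<Oplus>i\<in>A. f i j)"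
proof (induction A rule: finite_induct)
  case empty then show ?case by simp
next
  case (insert a A)
  have "(\<Oplus>j\<in>B. \<Oplus>i\<in>insert a A. f i j) = (\<Oplus>j\<in>B. f a j \<oplus> (\<Oplus>i\<in>A. f i j))"
    using insert by (intro finsum_cong') (auto intro!: finsum_closed)
  also have "\<dots> = (\<Oplus>j\<in>B. f a j) \<oplus> (\<Oplus>j\<in>B. \<Oplus>i\<in>A. f i j)"
    using insert by (intro finsum_addf) (auto intro!: finsum_closed)
  finally show ?case using insert by (subst finsum_insert) (auto intro!: finsum_closed)
qed

lemma matrix_ring_is_nonunital_ring: "nonunital_ring (matrix_ring R n)"
proof -
  let ?M = "matrix_ring R n"
  have "abelian_group ?M"
  proof (intro abelian_groupI, goal_cases)
    case (6 x)
    then show ?case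
      by (intro bexI[of _ "mat n n (\<lambda>(i,j). \<ominus> (x $$ (i,j)))"])
        (auto simp: matrix_ring_def l_neg intro!: eq_matI)
  qed (auto simp: matrix_ring_def a_ac intro!: eq_matI)
  then show ?thesis
  proof (rule nonunital_ring.intro, unfold_locales, goal_cases)
    case (2 x y z)
    have "(\<Oplus>k\<in>{..<n}. mat n n (\<lambda>(i,k). \<Oplus>l\<in>{..<n}. x $$ (i,l) \<otimes> y $$ (l,k)) $$ (i,k) \<otimes> z $$ (k,j))
        = (\<Oplus>l\<in>{..<n}. x $$ (i,l) \<otimes> mat n n (\<lambda>(l,j). \<Oplus>k\<in>{..<n}. y $$ (l,k) \<otimes> z $$ (k,j)) $$ (l,j))"
      if "i < n" "j < n" for i j
    proof -
      have c: "\<And>i j. i<n \<Longrightarrow> j<n \<Longrightarrow> x $$ (i,j) \<in> carrier R"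
        "\<And>i j. i<n \<Longrightarrow> j<n \<Longrightarrow> y $$ (i,j) \<in> carrier R"
        "\<And>i j. i<n \<Longrightarrow> j<n \<Longrightarrow> z $$ (i,j) \<in> carrier R"
        using 2 by (auto simp: matrix_ring_def)
      have "(\<Oplus>k\<in>{..<n}. mat n n (\<lambda>(i,k). \<Oplus>l\<in>{..<n}. x $$ (i,l) \<otimes> y $$ (l,k)) $$ (i,k) \<otimes> z $$ (k,j))
         = (\<Oplus>k\<in>{..<n}. \<Oplus>l\<in>{..<n}. x $$ (i,l) \<otimes> (y $$ (l,k) \<otimes> z $$ (k,j)))"
        using that c by (intro finsum_cong') (auto simp: finsum_right_mult mult_closed mult_assoc Pi_def intro!: finsum_closed finsum_cong')
      also have "\<dots> = (\<Oplus>l\<in>{..<n}. \<Oplus>k\<in>{..<n}. x $$ (i,l) \<otimes> (y $$ (l,k) \<otimes> z $$ (k,j)))"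
        using that c by (intro finsum_swap) (auto simp: mult_closed)
      also have "\<dots> = (\<Oplus>l\<in>{..<n}. x $$ (i,l) \<otimes> mat n n (\<lambda>(l,j). \<Oplus>k\<in>{..<n}. y $$ (l,k) \<otimes> z $$ (k,j)) $$ (l,j))"
        using that c by (intro finsum_cong') (auto simp: finsum_left_mult mult_closed Pi_def intro!: finsum_closed)
      finally show ?thesis .
    qed
    then show ?case by (auto simp: matrix_ring_def intro!: eq_matI)
  next
    case (3 x y z)
    have "(\<Oplus>k\<in>{..<n}. mat n n (\<lambda>(i,k). x $$ (i,k) \<oplus> y $$ (i,k)) $$ (i,k) \<otimes> z $$ (k,j))
       = (\<Oplus>k\<in>{..<n}. x $$ (i,k) \<otimes> z $$ (k,j)) \<oplus> (\<Oplus>k\<in>{..<n}. y $$ (i,k) \<otimes> z $$ (k,j))"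
      if "i < n" "j < n" for i j
      using that 3 by (intro trans[OF _ finsum_addf] finsum_cong')
        (auto simp: matrix_ring_def left_distrib mult_closed intro!: finsum_cong')
    then show ?case by (auto simp: matrix_ring_def intro!: eq_matI)
  next
    case (4 x y z)
    have "(\<Oplus>k\<in>{..<n}. z $$ (i,k) \<otimes> mat n n (\<lambda>(k,j). x $$ (k,j) \<oplus> y $$ (k,j)) $$ (k,j))
       = (\<Oplus>k\<in>{..<n}. z $$ (i,k) \<otimes> x $$ (k,j)) \<oplus> (\<Oplus>k\<in>{..<n}. z $$ (i,k) \<otimes> y $$ (k,j))"
      if "i < n" "j < n" for i j
      using that 4 by (intro trans[OF _ finsum_addf] finsum_cong')
        (auto simp: matrix_ring_def right_distrib mult_closed intro!: finsum_cong')
    then show ?case by (auto simp: matrix_ring_def intro!: eq_matI)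
  qed (auto simp: matrix_ring_def mult_closed intro!: finsum_closed)
qed

end

end

theory Submission
  imports Defs
begin

text \<open>
  The heart of the matter is that every idempotent \<open>e\<close> of \<open>R\<close> splits as \<open>e = \<alpha>\<^sub>1\<beta>\<^sub>1 = \<alpha>\<^sub>2\<beta>\<^sub>2\<close> with
  \<open>\<alpha>\<^sub>i\<beta>\<^sub>j = 0\<close> for \<open>i \<noteq> j\<close>, inside the unital corner \<open>eRe\<close>.  Such a splitting is immediate from an
  idempotent \<open>f\<close> for which both \<open>f\<close> and \<open>1 - f\<close> generate the unit ideal, since pure infiniteness
  then writes \<open>1\<close> as \<open>x f y\<close> and as \<open>x' (1 - f) y'\<close>.  In general only less is found at once: for
  every proper ideal \<open>J\<close> of the corner there is a full idempotent \<open>f'\<close> with \<open>1 - f'\<close> outside \<open>J\<close>.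
  This is obtained in a maximal ideal \<open>M\<close> above \<open>J\<close>: the simple quotient by \<open>M\<close> is not a division
  ring, so it has a nontrivial idempotent; the exchange property lifts it to some \<open>f\<close>, and a second
  use of exchange adds to \<open>f\<close> an orthogonal idempotent lying in \<open>M\<close> that makes it full.  The
  argument is applied to the ideal \<open>J\<close> of those \<open>z\<close> with \<open>1 \<oplus> z \<lesssim> 1\<close> (here \<open>\<lesssim>\<close> means factoring
  through, and \<open>\<oplus>\<close> is the block sum): fullness of \<open>f'\<close> gives \<open>1 - f' \<in> J\<close>, so \<open>J\<close>
  cannot be proper, and \<open>1 \<in> J\<close> is the desired splitting (\<open>one_properly_infinite\<close>).

  That the corner \<open>eRe\<close> has no division ring quotient is a rank argument.  If \<open>eRe/J\<close> were a
  division ring, then \<open>e r (1 - e) s e \<in> J\<close> for all \<open>r, s\<close>, as otherwise \<open>ReR\<close> would contain an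
  element of rank two modulo \<open>J\<close>, whereas all its elements factor through \<open>e\<close> and have rank at most
  one.  Hence \<open>r \<mapsto> e r e\<close> is multiplicative modulo \<open>J\<close>, and \<open>eRe/J\<close> is a quotient of \<open>R\<close>, which is
  excluded.

  Iterating the splitting gives arbitrarily many orthogonal isometries over every idempotent.  With
  them a finite square array of elements of \<open>R\<close> is compressed into a single element \<open>b\<close> from which each
  entry is recovered by multiplying on both sides (\<open>compress_array\<close>).  For the array \<open>diag(a, a)\<close>,
  the element \<open>b\<close> lies in \<open>RaR\<close>, hence is of the form \<open>x a y\<close>, which says that \<open>a\<close> is properly
  infinite.  For the array of entries of a matrix \<open>A\<close>, the elements witnessing that \<open>b\<close> is properly
  infinite turn into rank-one matrices witnessing the same for \<open>A\<close>.
\<close>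

section \<open>Idempotents and ideals in unital exchange rings\<close>

context ring
begin

lemma complementary_idempotent:
  assumes f: "f \<in> carrier R" "f \<otimes> f = f"
  shows "(\<one> \<ominus> f) \<otimes> (\<one> \<ominus> f) = \<one> \<ominus> f" "f \<otimes> (\<one> \<ominus> f) = \<zero>" "(\<one> \<ominus> f) \<otimes> f = \<zero>"
proof -
  show 1: "f \<otimes> (\<one> \<ominus> f) = \<zero>" "(\<one> \<ominus> f) \<otimes> f = \<zero>"
    using f by (simp_all add: minus_eq l_distr r_distr l_minus r_minus r_neg)
  have "(\<one> \<ominus> f) \<otimes> (\<one> \<ominus> f) = (\<one> \<ominus> f) \<ominus> f \<otimes> (\<one> \<ominus> f)"
    using f(1) by algebra
  then show "(\<one> \<ominus> f) \<otimes> (\<one> \<ominus> f) = \<one> \<ominus> f" using 1 f by (simp add: minus_eq)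
qed

text \<open>
  The normalisation set of \<^locale>\<open>ring\<close> leaves \<open>x \<otimes> \<one>\<close> to commutativity; products here do not commute.
\<close>

lemmas r_one_normalization
  [algebra ring "zero R" "add R" "a_inv R" "a_minus R" "one R" "mult R"] = r_one

lemma ideal_intro:
  assumes "I \<subseteq> carrier R" "\<zero> \<in> I"
    and add: "\<And>a b. a \<in> I \<Longrightarrow> b \<in> I \<Longrightarrow> a \<oplus> b \<in> I"
    and lmult: "\<And>a x. a \<in> I \<Longrightarrow> x \<in> carrier R \<Longrightarrow> x \<otimes> a \<in> I"
    and rmult: "\<And>a x. a \<in> I \<Longrightarrow> x \<in> carrier R \<Longrightarrow> a \<otimes> x \<in> I"
  shows "ideal I R"
proof (rule idealI[OF ring_axioms _ lmult rmult])
  have "\<ominus> a \<in> I" if "a \<in> I" for a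
  proof -
    have "\<ominus> a = (\<ominus> \<one>) \<otimes> a" using that assms(1) by (auto simp: l_minus)
    then show ?thesis using lmult[OF that, of "\<ominus> \<one>"] by simp
  qed
  then show "subgroup I (add_monoid R)"
    using assms(1,2) add by (intro add.subgroupI) (auto simp: a_inv_def)
qed

lemma exists_maximal_ideal_above:
  assumes "ideal J R" "\<one> \<notin> J"
  obtains M where "ideal M R" "J \<subseteq> M" "\<one> \<notin> M"
    and "\<And>I. ideal I R \<Longrightarrow> M \<subseteq> I \<Longrightarrow> \<one> \<notin> I \<Longrightarrow> I = M"
proof -
  let ?A = "{I. ideal I R \<and> J \<subseteq> I \<and> \<one> \<notin> I}"
  have "\<exists>M\<in>?A. \<forall>X\<in>?A. M \<subseteq> X \<longrightarrow> X = M"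
  proof (rule subset_Zorn_nonempty)
    show "?A \<noteq> {}" using assms by blast
  next
    fix C assume C: "C \<noteq> {}" "subset.chain ?A C"
    then have id: "ideal I R" if "I \<in> C" for I using that by (auto simp: subset.chain_def)
    have add: "additive_subgroup I R" if "I \<in> C" for I
      using id[OF that] by (rule ideal.axioms(1))
    have "ideal (\<Union>C) R"
    proof (rule ideal_intro)
      show "\<Union>C \<subseteq> carrier R" using additive_subgroup.a_subset[OF add] by blast
      show "\<zero> \<in> \<Union>C" using C(1) additive_subgroup.zero_closed[OF add] by blast
    next
      fix a b assume "a \<in> \<Union>C" "b \<in> \<Union>C"
      then obtain I K where IK: "I \<in> C" "K \<in> C" "a \<in> I" "b \<in> K" by blast
      have "I \<subseteq> K \<or> K \<subseteq> I" using C(2) IK(1,2) unfolding subset.chain_def by blast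
      then obtain L where L: "L \<in> C" "a \<in> L" "b \<in> L" using IK by blast
      have "a \<oplus> b \<in> L" by (rule additive_subgroup.a_closed[OF add[OF L(1)] L(2,3)])
      then show "a \<oplus> b \<in> \<Union>C" using L(1) by blast
    next
      fix a x assume "a \<in> \<Union>C" and x: "x \<in> carrier R"
      then obtain I where I: "I \<in> C" "a \<in> I" by blast
      show "x \<otimes> a \<in> \<Union>C" "a \<otimes> x \<in> \<Union>C"
        using ideal.I_l_closed[OF id[OF I(1)] I(2) x] ideal.I_r_closed[OF id[OF I(1)] I(2) x] I(1)
        by (auto intro!: UnionI)
    qed
    moreover have JC: "J \<subseteq> I" "\<one> \<notin> I" if "I \<in> C" for I
      using that C(2) by (auto simp: subset.chain_def)
    moreover have "J \<subseteq> \<Union>C" using C(1) JC(1) by blast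
    ultimately show "\<Union>C \<in> ?A" by simp
  qed
  then obtain M where M: "M \<in> ?A" "\<forall>X\<in>?A. M \<subseteq> X \<longrightarrow> X = M" by (rule bexE)
  show ?thesis
  proof (rule that)
    show "ideal M R" "J \<subseteq> M" "\<one> \<notin> M" using M(1) by auto
    show "I = M" if "ideal I R" "M \<subseteq> I" "\<one> \<notin> I" for I
      using bspec[OF M(2), of I] M(1) that by auto
  qed
qed

text \<open>
  If \<open>x a y \<equiv> 1\<close> modulo \<open>M\<close>, then \<open>a y x\<close> and \<open>y x a\<close> are nonzero idempotents modulo \<open>M\<close>.  Were both
  congruent to \<open>1\<close>, then \<open>y x\<close> would be an inverse of \<open>a\<close>; so a non-invertible \<open>a\<close> yields a
  nontrivial one.
\<close>

lemma nontrivial_idempotent_modulo_maximal_ideal: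
  assumes M: "ideal M R" "\<one> \<notin> M"
    and full: "\<And>a. a \<in> carrier R - M \<Longrightarrow>
      \<exists>x\<in>carrier R. \<exists>y\<in>carrier R. \<one> \<ominus> x \<otimes> a \<otimes> y \<in> M"
    and noninv: "\<exists>a\<in>carrier R - M. \<forall>b\<in>carrier R.
      \<not> (a \<otimes> b \<ominus> \<one> \<in> M \<and> b \<otimes> a \<ominus> \<one> \<in> M)"
  obtains p where "p \<in> carrier R" "p \<otimes> p \<ominus> p \<in> M" "p \<notin> M" "\<one> \<ominus> p \<notin> M"
proof -
  interpret M: ideal M R by fact
  obtain a where a: "a \<in> carrier R" "a \<notin> M"
    and na: "\<And>b. b \<in> carrier R \<Longrightarrow> \<not> (a \<otimes> b \<ominus> \<one> \<in> M \<and> b \<otimes> a \<ominus> \<one> \<in> M)"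
    using noninv by blast
  obtain x y where xy: "x \<in> carrier R" "y \<in> carrier R" and m: "\<one> \<ominus> x \<otimes> a \<otimes> y \<in> M"
    using full[of a] a by blast
  define m where "m = \<one> \<ominus> x \<otimes> a \<otimes> y"
  have mc: "m \<in> carrier R" "m \<in> M" using m xy a by (auto simp: m_def)
  have k: "x \<otimes> a \<otimes> y = \<one> \<ominus> m" using xy a unfolding m_def by algebra
  have neg: "\<one> \<ominus> p \<notin> M" if "p \<ominus> \<one> \<notin> M" "p \<in> carrier R" for p
  proof
    assume "\<one> \<ominus> p \<in> M"
    then have "\<ominus> (\<one> \<ominus> p) \<in> M" by (rule M.a_inv_closed)
    moreover have "\<ominus> (\<one> \<ominus> p) = p \<ominus> \<one>" using that(2) by algebra
    ultimately show False using that by simp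
  qed
  \<comment> \<open>\<open>x a y\<close> is congruent to \<open>1\<close>, hence so is its square, which contains either candidate as a factor.\<close>
  have one_if: "\<one> \<in> M" if "(\<one> \<ominus> m) \<otimes> (\<one> \<ominus> m) \<in> M"
  proof -
    have "\<one> = (\<one> \<ominus> m) \<otimes> (\<one> \<ominus> m) \<oplus> (m \<oplus> m \<otimes> (\<one> \<ominus> m))" using mc by algebra
    moreover have "m \<oplus> m \<otimes> (\<one> \<ominus> m) \<in> M" using mc by (simp add: M.I_r_closed)
    ultimately show ?thesis using that M.a_closed by metis
  qed
  have "a \<otimes> (y \<otimes> x) \<ominus> \<one> \<notin> M \<or> (y \<otimes> x) \<otimes> a \<ominus> \<one> \<notin> M"
    using na[of "y \<otimes> x"] xy by auto
  then show ?thesis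
  proof
    assume *: "a \<otimes> (y \<otimes> x) \<ominus> \<one> \<notin> M"
    let ?p = "a \<otimes> (y \<otimes> x)"
    have "?p \<otimes> ?p = a \<otimes> y \<otimes> (x \<otimes> a \<otimes> y) \<otimes> x" using xy a by algebra
    then have "?p \<otimes> ?p \<ominus> ?p = \<ominus> (a \<otimes> y \<otimes> m \<otimes> x)" unfolding k using xy a mc by algebra
    moreover have "\<ominus> (a \<otimes> y \<otimes> m \<otimes> x) \<in> M"
      using xy a mc by (intro M.a_inv_closed M.I_r_closed M.I_l_closed) auto
    moreover have "?p \<notin> M"
    proof
      assume "?p \<in> M"
      then have "x \<otimes> ?p \<otimes> (a \<otimes> y) \<in> M" using xy a(1) by (simp add: M.I_r_closed M.I_l_closed del: m_assoc)
      moreover have "x \<otimes> ?p \<otimes> (a \<otimes> y) = (x \<otimes> a \<otimes> y) \<otimes> (x \<otimes> a \<otimes> y)" using xy a by algebra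
      ultimately show False using one_if M(2) unfolding k by simp
    qed
    ultimately show ?thesis using that[of ?p] neg[OF *] xy a by simp
  next
    assume *: "(y \<otimes> x) \<otimes> a \<ominus> \<one> \<notin> M"
    let ?p = "(y \<otimes> x) \<otimes> a"
    have "?p \<otimes> ?p = y \<otimes> (x \<otimes> a \<otimes> y) \<otimes> (x \<otimes> a)" using xy a by algebra
    then have "?p \<otimes> ?p \<ominus> ?p = \<ominus> (y \<otimes> m \<otimes> (x \<otimes> a))" unfolding k using xy a mc by algebra
    moreover have "\<ominus> (y \<otimes> m \<otimes> (x \<otimes> a)) \<in> M"
      using xy a mc by (intro M.a_inv_closed M.I_r_closed M.I_l_closed) auto
    moreover have "?p \<notin> M"
    proof
      assume "?p \<in> M"
      then have "(x \<otimes> a) \<otimes> ?p \<otimes> y \<in> M" using xy a(1) by (simp add: M.I_r_closed M.I_l_closed del: m_assoc)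
      moreover have "(x \<otimes> a) \<otimes> ?p \<otimes> y = (x \<otimes> a \<otimes> y) \<otimes> (x \<otimes> a \<otimes> y)" using xy a by algebra
      ultimately show False using one_if M(2) unfolding k by simp
    qed
    ultimately show ?thesis using that[of ?p] neg[OF *] xy a by simp
  qed
qed

text \<open>
  The exchange property in the presence of \<open>1\<close>: since \<open>1 - (x + s - x s) = (1 - x)(1 - s)\<close>, the
  second condition on the idempotent becomes divisibility of \<open>1 - g\<close> by \<open>1 - x\<close>.
\<close>

definition exchange :: bool where
  "exchange \<longleftrightarrow> (\<forall>x\<in>carrier R. \<exists>g\<in>carrier R. \<exists>r\<in>carrier R. \<exists>t\<in>carrier R.
     g \<otimes> g = g \<and> g = x \<otimes> r \<and> \<one> \<ominus> g = (\<one> \<ominus> x) \<otimes> t)"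

lemma exchangeE:
  assumes exchange "x \<in> carrier R"
  obtains g r t where "g \<in> carrier R" "r \<in> carrier R" "t \<in> carrier R" "g \<otimes> g = g"
    "g = x \<otimes> r" "\<one> \<ominus> g = (\<one> \<ominus> x) \<otimes> t"
proof -
  have "\<exists>g\<in>carrier R. \<exists>r\<in>carrier R. \<exists>t\<in>carrier R.
     g \<otimes> g = g \<and> g = x \<otimes> r \<and> \<one> \<ominus> g = (\<one> \<ominus> x) \<otimes> t"
    using assms by (simp add: exchange_def)
  then show ?thesis using that by (elim bexE conjE)
qed

text \<open>
  Applied to \<open>p\<close> itself, exchange gives \<open>g = p r\<close> with \<open>1 - g = (1 - p) t\<close>.  Modulo \<open>I\<close> the first
  identity implies \<open>p g \<equiv> g\<close> and the second \<open>p g \<equiv> p\<close>.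
\<close>

lemma exchange_lifts_idempotents:
  assumes ex: exchange and I: "ideal I R"
    and p: "p \<in> carrier R" "p \<otimes> p \<ominus> p \<in> I"
  obtains g where "g \<in> carrier R" "g \<otimes> g = g" "p \<ominus> g \<in> I"
proof -
  interpret I: ideal I R by fact
  obtain g r t where g: "g \<in> carrier R" "r \<in> carrier R" "t \<in> carrier R" "g \<otimes> g = g"
    and gr: "g = p \<otimes> r" and gt: "\<one> \<ominus> g = (\<one> \<ominus> p) \<otimes> t"
    by (rule exchangeE[OF ex p(1)])
  let ?d = "p \<otimes> p \<ominus> p"
  have "p \<otimes> g \<ominus> g = ?d \<otimes> r" using p(1) g unfolding gr by algebra
  then have 1: "p \<otimes> g \<ominus> g \<in> I" using p g by (simp add: I.I_r_closed)
  have "p \<ominus> p \<otimes> g = p \<otimes> (\<one> \<ominus> g)" using p(1) g by algebra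
  also have "\<dots> = \<ominus> (?d \<otimes> t)" unfolding gt using p(1) g by algebra
  finally have 2: "p \<ominus> p \<otimes> g \<in> I" using p g by (auto simp: I.I_r_closed)
  have "p \<ominus> g = (p \<ominus> p \<otimes> g) \<oplus> (p \<otimes> g \<ominus> g)" using p(1) g by algebra
  then have "p \<ominus> g \<in> I" using 1 2 by simp
  then show ?thesis using that g by blast
qed

text \<open>
  An idempotent that is full modulo \<open>I\<close> becomes full after adding an orthogonal idempotent from \<open>I\<close>.
  Modulo an ideal \<open>Q\<close> that contains \<open>f\<close>, the element \<open>c = (1 - f) i (1 - f)\<close> of \<open>I\<close> is congruent
  to \<open>1\<close>; exchange replaces it by an idempotent \<open>h\<close> in the corner of \<open>1 - f\<close> with \<open>c h \<equiv> c \<equiv> 1\<close>, so \<open>Q\<close>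
  cannot contain \<open>h\<close> as well unless it is everything.
\<close>

lemma exchange_enlarge_idempotent:
  assumes ex: exchange and I: "ideal I R"
    and f: "f \<in> carrier R" "f \<otimes> f = f"
    and i: "i \<in> I" "x \<in> carrier R" "y \<in> carrier R" "\<one> = i \<oplus> x \<otimes> f \<otimes> y"
  obtains f' where "f' \<in> carrier R" "f' \<otimes> f' = f'" "f' \<ominus> f \<in> I"
    and "\<And>Q. ideal Q R \<Longrightarrow> f' \<in> Q \<Longrightarrow> \<one> \<in> Q"
proof -
  interpret I: ideal I R by fact
  define f1 where "f1 = \<one> \<ominus> f"
  have f1: "f1 \<in> carrier R" "f1 \<otimes> f1 = f1" "f \<otimes> f1 = \<zero>" "f1 \<otimes> f = \<zero>"
    using f complementary_idempotent[OF f] unfolding f1_def by simp_all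
  have ic: "i \<in> carrier R" using i(1) by simp
  define c where "c = f1 \<otimes> i \<otimes> f1"
  have c: "c \<in> carrier R" "c \<in> I" "f \<otimes> c = \<zero>" "c \<otimes> f1 = c"
  proof -
    show "c \<in> carrier R" unfolding c_def using f1 ic by simp
    show "c \<in> I" unfolding c_def using f1 i(1) by (simp add: I.I_l_closed I.I_r_closed)
    have "f \<otimes> c = (f \<otimes> f1) \<otimes> (i \<otimes> f1)" unfolding c_def using f1(1) f(1) ic by algebra
    then show "f \<otimes> c = \<zero>" using f1 ic by simp
    have "c \<otimes> f1 = f1 \<otimes> i \<otimes> (f1 \<otimes> f1)" unfolding c_def using f1(1) ic by algebra
    then show "c \<otimes> f1 = c" using f1 by (simp add: c_def)
  qed
  obtain g r t where g: "g \<in> carrier R" "r \<in> carrier R" "t \<in> carrier R" "g \<otimes> g = g"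
    and gr: "g = c \<otimes> r" and gt: "\<one> \<ominus> g = (\<one> \<ominus> c) \<otimes> t"
    by (rule exchangeE[OF ex c(1)])
  have f1g: "f1 \<otimes> g = g"
  proof -
    have "f1 \<otimes> c = (f1 \<otimes> f1) \<otimes> (i \<otimes> f1)" unfolding c_def using f1(1) ic by algebra
    then have f1c: "f1 \<otimes> c = c" unfolding f1(2) c_def using f1(1) ic by (simp add: m_assoc)
    have "f1 \<otimes> g = (f1 \<otimes> c) \<otimes> r" unfolding gr using c(1) f1(1) g(2) by (simp add: m_assoc)
    then show ?thesis unfolding f1c gr .
  qed
  \<comment> \<open>\<open>g\<close> is only left invariant under \<open>1 - f\<close>; cutting on the right makes it orthogonal to \<open>f\<close>.\<close>
  define h where "h = g \<otimes> f1"
  have h: "h \<in> carrier R" "h \<in> I" "h \<otimes> h = h" "f \<otimes> h = \<zero>" "h \<otimes> f = \<zero>"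
  proof -
    show "h \<in> carrier R" unfolding h_def using g f1 by simp
    show "h \<in> I" unfolding h_def gr using c f1 g by (simp add: I.I_r_closed)
    have "h \<otimes> h = g \<otimes> (f1 \<otimes> g) \<otimes> f1" unfolding h_def using g(1) f1(1) by algebra
    then show "h \<otimes> h = h" unfolding f1g g h_def .
    have "f \<otimes> h = (f \<otimes> c) \<otimes> (r \<otimes> f1)" unfolding h_def gr using f(1) f1(1) c(1) g(2) by algebra
    then show "f \<otimes> h = \<zero>" using c f1 g by simp
    show "h \<otimes> f = \<zero>" unfolding h_def using g f1 f by (simp add: m_assoc)
  qed
  show ?thesis
  proof (rule that[of "f \<oplus> h"])
    show "f \<oplus> h \<in> carrier R" using f h by simp
    show "(f \<oplus> h) \<otimes> (f \<oplus> h) = f \<oplus> h"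
      using f h by (simp add: l_distr r_distr)
    have "f \<oplus> h \<ominus> f = h" using f(1) h(1) by algebra
    then show "f \<oplus> h \<ominus> f \<in> I" using h by simp
  next
    fix Q assume Q: "ideal Q R" and fh: "f \<oplus> h \<in> Q"
    interpret Q: ideal Q R by fact
    have "f \<otimes> (f \<oplus> h) = f" "h \<otimes> (f \<oplus> h) = h"
      using f h by (simp_all add: r_distr)
    then have fQ: "f \<in> Q" and hQ: "h \<in> Q"
      using Q.I_l_closed[OF fh f(1)] Q.I_l_closed[OF fh h(1)] by auto
    define k where "k = x \<otimes> f \<otimes> y"
    have k: "k \<in> Q" "k \<in> carrier R"
      using fQ i f unfolding k_def by (simp_all add: Q.I_l_closed Q.I_r_closed)
    have ieq: "i = \<one> \<ominus> k" unfolding i(4) k_def[symmetric] using k(2) ic by algebra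
    have "c = f1 \<otimes> f1 \<ominus> f1 \<otimes> k \<otimes> f1" unfolding c_def ieq using f1(1) k(2) by algebra
    then have "\<one> \<ominus> c = f \<oplus> f1 \<otimes> k \<otimes> f1"
      unfolding f1(2) unfolding f1_def using f(1) k(2) by algebra
    moreover have "f \<oplus> f1 \<otimes> k \<otimes> f1 \<in> Q"
      using fQ k f1 by (simp add: Q.I_l_closed Q.I_r_closed)
    ultimately have cQ: "\<one> \<ominus> c \<in> Q" by simp
    have "c \<otimes> f1 \<ominus> c \<otimes> g \<otimes> f1 = c \<otimes> (\<one> \<ominus> g) \<otimes> f1" using c(1) g(1) f1(1) by algebra
    also have "\<dots> = c \<otimes> (\<one> \<ominus> c) \<otimes> t \<otimes> f1" unfolding gt using c(1) g(3) f1(1) by algebra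
    also have "c \<otimes> f1 \<ominus> c \<otimes> g \<otimes> f1 = c \<ominus> c \<otimes> h" unfolding c(4) h_def using c g f1 by (simp add: m_assoc)
    finally have e: "c \<ominus> c \<otimes> h = c \<otimes> (\<one> \<ominus> c) \<otimes> t \<otimes> f1" .
    have "\<one> = (\<one> \<ominus> c) \<oplus> (c \<ominus> c \<otimes> h) \<oplus> c \<otimes> h" using c(1) h(1) by algebra
    also have "\<dots> \<in> Q" unfolding e using cQ hQ c g f1
      by (auto simp: Q.I_l_closed Q.I_r_closed)
    finally show "\<one> \<in> Q" .
  qed
qed

section \<open>Proper infiniteness of the identity\<close>

text \<open>
  The relation \<open>1 \<oplus> z \<lesssim> 1\<close>: the matrix \<open>diag(1, z)\<close> is the product of the column \<open>(\<alpha>, \<gamma>)\<close> and the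
  row \<open>(\<beta>, \<delta>)\<close>.
\<close>

definition absorbed_by_one :: "'a \<Rightarrow> bool" where
  "absorbed_by_one z \<longleftrightarrow> (\<exists>\<alpha>\<in>carrier R. \<exists>\<beta>\<in>carrier R. \<exists>\<gamma>\<in>carrier R. \<exists>\<delta>\<in>carrier R.
     \<alpha> \<otimes> \<beta> = \<one> \<and> \<alpha> \<otimes> \<delta> = \<zero> \<and> \<gamma> \<otimes> \<beta> = \<zero> \<and> \<gamma> \<otimes> \<delta> = z)"

lemma absorbed_by_oneE:
  assumes "absorbed_by_one z"
  obtains \<alpha> \<beta> \<gamma> \<delta> where "\<alpha> \<in> carrier R" "\<beta> \<in> carrier R" "\<gamma> \<in> carrier R" "\<delta> \<in> carrier R"
    "\<alpha> \<otimes> \<beta> = \<one>" "\<alpha> \<otimes> \<delta> = \<zero>" "\<gamma> \<otimes> \<beta> = \<zero>" "\<gamma> \<otimes> \<delta> = z"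
  using assms that unfolding absorbed_by_one_def by (elim bexE conjE)

text \<open>
  For sums, absorb \<open>b\<close> into \<open>1\<close> first and then \<open>a\<close> into the remaining copy of \<open>1\<close>: this gives
  \<open>1 \<oplus> a \<oplus> b \<lesssim> 1\<close>, and \<open>a + b \<lesssim> a \<oplus> b\<close>.
\<close>

lemma absorbed_by_one_ideal: "ideal {z. absorbed_by_one z} R"
proof (rule ideal_intro; (unfold mem_Collect_eq)?)
  show "{z. absorbed_by_one z} \<subseteq> carrier R" unfolding absorbed_by_one_def by auto
  show "absorbed_by_one \<zero>"
    unfolding absorbed_by_one_def
    by (rule bexI[of _ \<one>], rule bexI[of _ \<one>], rule bexI[of _ \<zero>], rule bexI[of _ \<zero>]) auto
next
  fix a x assume a: "absorbed_by_one a" and x: "x \<in> carrier R"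
  obtain \<alpha> \<beta> \<gamma> \<delta> where *: "\<alpha> \<in> carrier R" "\<beta> \<in> carrier R" "\<gamma> \<in> carrier R" "\<delta> \<in> carrier R"
    "\<alpha> \<otimes> \<beta> = \<one>" "\<alpha> \<otimes> \<delta> = \<zero>" "\<gamma> \<otimes> \<beta> = \<zero>" "\<gamma> \<otimes> \<delta> = a"
    by (rule absorbed_by_oneE[OF a])
  show "absorbed_by_one (x \<otimes> a)"
    unfolding absorbed_by_one_def
    by (rule bexI[of _ \<alpha>], rule bexI[of _ \<beta>], rule bexI[of _ "x \<otimes> \<gamma>"], rule bexI[of _ \<delta>])
      (use * x in \<open>auto simp: m_assoc\<close>)
  show "absorbed_by_one (a \<otimes> x)"
    unfolding absorbed_by_one_def
    by (rule bexI[of _ \<alpha>], rule bexI[of _ \<beta>], rule bexI[of _ \<gamma>], rule bexI[of _ "\<delta> \<otimes> x"])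
      (use * x in \<open>auto simp: m_assoc[symmetric]\<close>)
next
  fix a b assume ab: "absorbed_by_one a" "absorbed_by_one b"
  obtain \<alpha> \<beta> \<gamma> \<delta> where c: "\<alpha> \<in> carrier R" "\<beta> \<in> carrier R" "\<gamma> \<in> carrier R" "\<delta> \<in> carrier R"
    and 1: "\<alpha> \<otimes> \<beta> = \<one>" "\<alpha> \<otimes> \<delta> = \<zero>" "\<gamma> \<otimes> \<beta> = \<zero>" "\<gamma> \<otimes> \<delta> = a"
    by (rule absorbed_by_oneE[OF ab(1)])
  obtain \<alpha>' \<beta>' \<gamma>' \<delta>' where
      c': "\<alpha>' \<in> carrier R" "\<beta>' \<in> carrier R" "\<gamma>' \<in> carrier R" "\<delta>' \<in> carrier R"
    and 2: "\<alpha>' \<otimes> \<beta>' = \<one>" "\<alpha>' \<otimes> \<delta>' = \<zero>" "\<gamma>' \<otimes> \<beta>' = \<zero>" "\<gamma>' \<otimes> \<delta>' = b"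
    by (rule absorbed_by_oneE[OF ab(2)])
  note c = c c'
  have ab: "a \<in> carrier R" "b \<in> carrier R" using 1(4) 2(4) c by auto
  have mid: "x \<otimes> \<alpha>' \<otimes> (\<beta>' \<otimes> y) = x \<otimes> y" "x \<otimes> \<alpha>' \<otimes> \<delta>' = \<zero>" "\<gamma>' \<otimes> (\<beta>' \<otimes> y) = \<zero>"
    if "x \<in> carrier R" "y \<in> carrier R" for x y
  proof -
    have "x \<otimes> \<alpha>' \<otimes> (\<beta>' \<otimes> y) = x \<otimes> (\<alpha>' \<otimes> \<beta>') \<otimes> y" using that c by algebra
    then show "x \<otimes> \<alpha>' \<otimes> (\<beta>' \<otimes> y) = x \<otimes> y" using 2 that by simp
    show "x \<otimes> \<alpha>' \<otimes> \<delta>' = \<zero>" using 2 that c by (simp add: m_assoc)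
    show "\<gamma>' \<otimes> (\<beta>' \<otimes> y) = \<zero>" using 2 that c by (simp add: m_assoc[symmetric])
  qed
  show "absorbed_by_one (a \<oplus> b)"
    unfolding absorbed_by_one_def
    by (rule bexI[of _ "\<alpha> \<otimes> \<alpha>'"], rule bexI[of _ "\<beta>' \<otimes> \<beta>"],
        rule bexI[of _ "\<gamma> \<otimes> \<alpha>' \<oplus> \<gamma>'"], rule bexI[of _ "\<beta>' \<otimes> \<delta> \<oplus> \<delta>'"])
      (use c ab in \<open>auto simp: l_distr r_distr mid 1 2(4)\<close>)
qed

text \<open>
  The hypothesis on \<open>x a y + x' a y'\<close> makes the set of all \<open>x a y\<close> an ideal; thus each element outside a
  maximal ideal \<open>M\<close> is full modulo \<open>M\<close> through a single sandwich.  The ideal of absorbed elements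
  cannot be contained in such an \<open>M\<close>, because there is a full idempotent \<open>f'\<close> with \<open>1 - f' \<notin> M\<close>, and
  the complement of a full idempotent is absorbed.
\<close>

theorem one_properly_infinite:
  assumes ex: exchange
    and pi: "\<And>a x y x' y'. {a, x, y, x', y'} \<subseteq> carrier R \<Longrightarrow>
      \<exists>v\<in>carrier R. \<exists>w\<in>carrier R. x \<otimes> a \<otimes> y \<oplus> x' \<otimes> a \<otimes> y' = v \<otimes> a \<otimes> w"
    and nd: "\<And>I. ideal I R \<Longrightarrow> \<one> \<notin> I \<Longrightarrow> \<exists>a\<in>carrier R - I. \<forall>b\<in>carrier R.
      \<not> (a \<otimes> b \<ominus> \<one> \<in> I \<and> b \<otimes> a \<ominus> \<one> \<in> I)"
  shows "absorbed_by_one \<one>"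
proof (rule ccontr)
  define T where "T a = {x \<otimes> a \<otimes> y | x y. x \<in> carrier R \<and> y \<in> carrier R}" for a
  have T: "ideal (T a) R" "a \<in> T a" if a: "a \<in> carrier R" for a
  proof -
    have "a = \<one> \<otimes> a \<otimes> \<one>" using a by simp
    then show "a \<in> T a" unfolding T_def by blast
    show "ideal (T a) R"
    proof (rule ideal_intro)
      show "T a \<subseteq> carrier R" unfolding T_def using a by auto
      have "\<zero> = \<zero> \<otimes> a \<otimes> \<zero>" using a by simp
      then show "\<zero> \<in> T a" unfolding T_def by blast
    next
      fix u v assume uv: "u \<in> T a" "v \<in> T a"
      obtain x y where 1: "x \<in> carrier R" "y \<in> carrier R" "u = x \<otimes> a \<otimes> y"
        using uv(1) by (auto simp: T_def)
      obtain x' y' where 2: "x' \<in> carrier R" "y' \<in> carrier R" "v = x' \<otimes> a \<otimes> y'"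
        using uv(2) by (auto simp: T_def)
      show "u \<oplus> v \<in> T a"
        using pi[of a x y x' y'] 1 2 a unfolding T_def by auto
    next
      fix u z assume "u \<in> T a" and z: "z \<in> carrier R"
      then obtain x y where xy: "x \<in> carrier R" "y \<in> carrier R" "u = x \<otimes> a \<otimes> y"
        by (auto simp: T_def)
      then have "z \<otimes> u = (z \<otimes> x) \<otimes> a \<otimes> y" "u \<otimes> z = x \<otimes> a \<otimes> (y \<otimes> z)"
        using z a by (simp_all add: m_assoc)
      then show "z \<otimes> u \<in> T a" "u \<otimes> z \<in> T a" unfolding T_def using xy z by blast+
    qed
  qed
  assume "\<not> absorbed_by_one \<one>"
  then obtain M where M: "ideal M R" "{z. absorbed_by_one z} \<subseteq> M" "\<one> \<notin> M"
    and max: "\<And>I. ideal I R \<Longrightarrow> M \<subseteq> I \<Longrightarrow> \<one> \<notin> I \<Longrightarrow> I = M"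
    using exists_maximal_ideal_above[OF absorbed_by_one_ideal] by auto
  interpret M: ideal M R by fact
  have full: "\<exists>x\<in>carrier R. \<exists>y\<in>carrier R. \<exists>m\<in>M. \<one> = m \<oplus> x \<otimes> a \<otimes> y"
    if a: "a \<in> carrier R - M" for a
  proof -
    let ?I = "M <+>\<^bsub>R\<^esub> T a"
    have I: "ideal ?I R" using add_ideals[OF M(1) T(1)] a by blast
    have sum: "m \<oplus> t \<in> ?I" if "m \<in> M" "t \<in> T a" for m t
      using that unfolding set_add_def' by blast
    have "\<zero> \<in> T a"
      using additive_subgroup.zero_closed[OF ideal.axioms(1)[OF T(1)]] a by blast
    then have sub: "M \<subseteq> ?I" using sum[of _ \<zero>] M.a_Hcarr by auto
    have "a \<in> ?I" using sum[OF M.zero_closed T(2)] a by auto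
    then have "?I \<noteq> M" using a by blast
    then have "\<one> \<in> ?I" using max[OF I sub] by blast
    then obtain m t where "m \<in> M" "t \<in> T a" "\<one> = m \<oplus> t" unfolding set_add_def' by blast
    then show ?thesis unfolding T_def by auto
  qed
  have full': "\<exists>x\<in>carrier R. \<exists>y\<in>carrier R. \<one> \<ominus> x \<otimes> a \<otimes> y \<in> M" if a: "a \<in> carrier R - M" for a
  proof -
    obtain x y m where *: "x \<in> carrier R" "y \<in> carrier R" "m \<in> M" "\<one> = m \<oplus> x \<otimes> a \<otimes> y"
      using full[OF a] by blast
    have "m \<in> carrier R" "x \<otimes> a \<otimes> y \<in> carrier R" using * a by auto
    then have "\<one> \<ominus> x \<otimes> a \<otimes> y = m" unfolding *(4) by algebra
    then show ?thesis using *(1-3) by (intro bexI[of _ x] bexI[of _ y]) simp_all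
  qed
  obtain p where p: "p \<in> carrier R" "p \<otimes> p \<ominus> p \<in> M" "p \<notin> M" "\<one> \<ominus> p \<notin> M"
    using nontrivial_idempotent_modulo_maximal_ideal[OF M(1,3) full' nd[OF M(1,3)]] by blast
  obtain f where f: "f \<in> carrier R" "f \<otimes> f = f" "p \<ominus> f \<in> M"
    using exchange_lifts_idempotents[OF ex M(1) p(1,2)] by blast
  have "f \<notin> M"
  proof
    assume "f \<in> M"
    then have "(p \<ominus> f) \<oplus> f \<in> M" using f by simp
    moreover have "(p \<ominus> f) \<oplus> f = p" using f(1) p(1) by algebra
    ultimately show False using p by simp
  qed
  then obtain x y i where i: "i \<in> M" "x \<in> carrier R" "y \<in> carrier R" "\<one> = i \<oplus> x \<otimes> f \<otimes> y"
    using full[of f] f by blast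
  obtain f' where f': "f' \<in> carrier R" "f' \<otimes> f' = f'" "f' \<ominus> f \<in> M"
    and ff: "\<And>Q. ideal Q R \<Longrightarrow> f' \<in> Q \<Longrightarrow> \<one> \<in> Q"
    using exchange_enlarge_idempotent[OF ex M(1) f(1,2) i] by blast
  have "\<one> \<in> T f'" using ff T f' by blast
  then obtain v w where vw: "v \<in> carrier R" "w \<in> carrier R" "v \<otimes> f' \<otimes> w = \<one>"
    unfolding T_def by auto
  define q where "q = \<one> \<ominus> f'"
  have q: "q \<in> carrier R" "q \<otimes> q = q" "f' \<otimes> q = \<zero>" "q \<otimes> f' = \<zero>"
    using f' complementary_idempotent[OF f'(1,2)] unfolding q_def by simp_all
  \<comment> \<open>The factorisation \<open>1 = v f' w\<close> leaves the complement \<open>q\<close> of \<open>f'\<close> free.\<close>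
  have "absorbed_by_one q"
    unfolding absorbed_by_one_def
  proof (rule bexI[of _ "v \<otimes> f'"], rule bexI[of _ "f' \<otimes> w"], rule bexI[of _ q], rule bexI[of _ q], intro conjI)
    have "v \<otimes> f' \<otimes> (f' \<otimes> w) = v \<otimes> (f' \<otimes> f') \<otimes> w"
      using vw(1,2) f'(1) by (simp add: m_assoc)
    then show "v \<otimes> f' \<otimes> (f' \<otimes> w) = \<one>" by (simp only: f'(2) vw(3))
    show "v \<otimes> f' \<otimes> q = \<zero>" using vw f' q by (simp add: m_assoc)
    show "q \<otimes> (f' \<otimes> w) = \<zero>" using vw f' q by (simp add: m_assoc[symmetric])
  qed (use q vw f' in auto)
  then have "q \<in> M" using M(2) by blast
  have "\<one> \<ominus> p = q \<oplus> (f' \<ominus> f) \<ominus> (p \<ominus> f)" unfolding q_def using p(1) f(1) f'(1) by algebra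
  moreover have "q \<oplus> (f' \<ominus> f) \<ominus> (p \<ominus> f) \<in> M"
    using \<open>q \<in> M\<close> f'(3) f(3) by (simp add: minus_eq)
  ultimately show False using p(4) by simp
qed

end

section \<open>Quotients and corners of nonunital rings\<close>

context nonunital_ring
begin

lemma mult_minus_left: "\<lbrakk>x \<in> carrier R; y \<in> carrier R\<rbrakk> \<Longrightarrow> \<ominus> x \<otimes> y = \<ominus> (x \<otimes> y)"
  by (rule minus_equality[symmetric])
    (simp_all add: mult_closed left_distrib[symmetric] l_neg zero_mult)

lemma mult_minus_right: "\<lbrakk>x \<in> carrier R; y \<in> carrier R\<rbrakk> \<Longrightarrow> x \<otimes> \<ominus> y = \<ominus> (x \<otimes> y)"
  by (rule minus_equality[symmetric])
    (simp_all add: mult_closed right_distrib[symmetric] l_neg mult_zero)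

lemma uminus_zero: "\<ominus> \<zero> = \<zero>"
  by (rule minus_equality) simp_all

text \<open>
  Rewrite rules that let the method \<open>algebra\<close> decide identities valid in all rings without identity.
\<close>

lemmas nonunital_normalization
  [algebra ring "zero R" "add R" "a_inv R" "a_minus R" "one R" "mult R"] =
  a_closed zero_closed a_inv_closed minus_closed mult_closed
  a_assoc l_zero l_neg a_comm mult_assoc left_distrib minus_eq
  r_zero r_neg r_neg2 r_neg1 minus_add minus_minus uminus_zero
  a_lcomm right_distrib zero_mult mult_zero mult_minus_left mult_minus_right

lemma two_sided_ideal_abelian_subgroup: "two_sided_ideal I R \<Longrightarrow> abelian_subgroup I R"
  unfolding two_sided_ideal_def
  by (intro abelian_subgroupI3 abelian_group_axioms) auto

lemma rcoset_mult_cosets: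
  assumes I: "two_sided_ideal I R" and x: "x \<in> carrier R" and y: "y \<in> carrier R"
  shows "rcoset_mult R I (I +> x) (I +> y) = I +> (x \<otimes> y)"
proof -
  interpret I: abelian_subgroup I R using I by (rule two_sided_ideal_abelian_subgroup)
  have "I +> (a \<otimes> b) = I +> (x \<otimes> y)" if ab: "a \<in> I +> x" "b \<in> I +> y" for a b
  proof -
    obtain h k where hk: "h \<in> I" "k \<in> I" "a = h \<oplus> x" "b = k \<oplus> y"
      using ab by (auto simp: a_r_coset_def')
    then have c: "h \<in> carrier R" "k \<in> carrier R" by auto
    have "h \<otimes> b \<in> I" "x \<otimes> k \<in> I"
      using I hk c x y by (auto simp: two_sided_ideal_def)
    then have "h \<otimes> b \<oplus> x \<otimes> k \<in> I" by simp
    moreover have "a \<otimes> b = (h \<otimes> b \<oplus> x \<otimes> k) \<oplus> x \<otimes> y" unfolding hk using c x y by algebra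
    ultimately have "a \<otimes> b \<in> I +> (x \<otimes> y)" by (auto simp: a_r_coset_def')
    then show ?thesis using I.a_repr_independence'[OF _ mult_closed[OF x y]] by simp
  qed
  moreover have "x \<in> I +> x" "y \<in> I +> y" using x y by (auto intro: I.a_rcos_self)
  ultimately show ?thesis unfolding rcoset_mult_def by blast
qed

lemma quotient_nonunital_ring:
  assumes I: "two_sided_ideal I R"
  shows "nonunital_ring (R Quot I)"
proof -
  interpret I: abelian_subgroup I R using I by (rule two_sided_ideal_abelian_subgroup)
  have "abelian_group (R Quot I)"
    by (rule comm_group_abelian_groupI)
      (simp add: FactRing_def I.a_factorgroup_is_comm_group[unfolded A_FactGroup_def'])
  then show ?thesis
  proof (rule nonunital_ring.intro, unfold_locales)
    fix X Y Z
    assume XYZ: "X \<in> carrier (R Quot I)" "Y \<in> carrier (R Quot I)"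
    then obtain x y where xy: "x \<in> carrier R" "y \<in> carrier R" "X = I +> x" "Y = I +> y"
      by (auto simp: FactRing_simps)
    then show "X \<otimes>\<^bsub>R Quot I\<^esub> Y \<in> carrier (R Quot I)"
      by (auto simp: FactRing_simps rcoset_mult_cosets[OF I] mult_closed)
    assume "Z \<in> carrier (R Quot I)"
    then obtain z where z: "z \<in> carrier R" "Z = I +> z"
      by (auto simp: FactRing_simps)
    note [simp] = FactRing_def rcoset_mult_cosets[OF I] I.a_rcos_sum mult_closed
    show "X \<otimes>\<^bsub>R Quot I\<^esub> Y \<otimes>\<^bsub>R Quot I\<^esub> Z = X \<otimes>\<^bsub>R Quot I\<^esub> (Y \<otimes>\<^bsub>R Quot I\<^esub> Z)"
      using xy z by (simp add: mult_assoc)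
    show "(X \<oplus>\<^bsub>R Quot I\<^esub> Y) \<otimes>\<^bsub>R Quot I\<^esub> Z = X \<otimes>\<^bsub>R Quot I\<^esub> Z \<oplus>\<^bsub>R Quot I\<^esub> Y \<otimes>\<^bsub>R Quot I\<^esub> Z"
      using xy z by (simp add: left_distrib)
    show "Z \<otimes>\<^bsub>R Quot I\<^esub> (X \<oplus>\<^bsub>R Quot I\<^esub> Y) = Z \<otimes>\<^bsub>R Quot I\<^esub> X \<oplus>\<^bsub>R Quot I\<^esub> Z \<otimes>\<^bsub>R Quot I\<^esub> Y"
      using xy z by (simp add: right_distrib)
  qed
qed

lemma quotient_is_division_ringI:
  assumes I: "two_sided_ideal I R" and e: "e \<in> carrier R" "e \<notin> I"
    and unit: "\<And>x. x \<in> carrier R \<Longrightarrow> e \<otimes> x \<ominus> x \<in> I \<and> x \<otimes> e \<ominus> x \<in> I"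
    and inv: "\<And>x. x \<in> carrier R - I \<Longrightarrow>
      \<exists>y\<in>carrier R. x \<otimes> y \<ominus> e \<in> I \<and> y \<otimes> x \<ominus> e \<in> I"
  shows "is_division_ring (R Quot I)"
proof -
  interpret I: abelian_subgroup I R using I by (rule two_sided_ideal_abelian_subgroup)
  have eq: "I +> x = I +> y \<longleftrightarrow> x \<ominus> y \<in> I" if "x \<in> carrier R" "y \<in> carrier R" for x y
    using that I.a_rcos_module[of y x] I.a_repr_independence'[of x y] I.a_rcos_self[of x]
    by (auto simp: minus_eq)
  have zero: "I +> x = I \<longleftrightarrow> x \<in> I" if "x \<in> carrier R" for x
    using eq[OF that zero_closed] that by (simp add: minus_eq uminus_zero a_coset_add_zero[OF I.a_subset])
  let ?e = "I +> e"
  have ring: "nonunital_ring (R Quot I)" using I by (rule quotient_nonunital_ring)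
  have one: "?e \<in> carrier (R Quot I)" "?e \<noteq> \<zero>\<^bsub>R Quot I\<^esub>"
    using e zero by (auto simp: FactRing_simps)
  have unital: "?e \<otimes>\<^bsub>R Quot I\<^esub> X = X \<and> X \<otimes>\<^bsub>R Quot I\<^esub> ?e = X" if X: "X \<in> carrier (R Quot I)" for X
  proof -
    obtain x where x: "x \<in> carrier R" "X = I +> x" using X by (auto simp: FactRing_simps)
    then show ?thesis
      using unit[OF x(1)] e by (simp add: FactRing_def rcoset_mult_cosets[OF I] eq mult_closed)
  qed
  have inverse: "\<exists>Y\<in>carrier (R Quot I). X \<otimes>\<^bsub>R Quot I\<^esub> Y = ?e \<and> Y \<otimes>\<^bsub>R Quot I\<^esub> X = ?e"
    if X: "X \<in> carrier (R Quot I)" "X \<noteq> \<zero>\<^bsub>R Quot I\<^esub>" for X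
  proof -
    obtain x where x: "x \<in> carrier R" "X = I +> x" using X by (auto simp: FactRing_simps)
    then have "x \<notin> I" using zero X by (simp add: FactRing_def)
    then obtain y where y: "y \<in> carrier R" "x \<otimes> y \<ominus> e \<in> I" "y \<otimes> x \<ominus> e \<in> I"
      using inv[of x] x by auto
    then have "X \<otimes>\<^bsub>R Quot I\<^esub> (I +> y) = ?e \<and> (I +> y) \<otimes>\<^bsub>R Quot I\<^esub> X = ?e"
      using x e by (simp add: FactRing_def rcoset_mult_cosets[OF I] eq mult_closed)
    moreover have "I +> y \<in> carrier (R Quot I)" using y by (auto simp: FactRing_simps)
    ultimately show ?thesis by blast
  qed
  show ?thesis
    unfolding is_division_ring_def
    by (rule conjI[OF ring], rule bexI[OF _ one(1)], intro conjI ballI impI; (elim inverse)?)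
      (use one(2) unital in simp_all)
qed

end

text \<open>
  For idempotent \<open>e\<close>, an element has the form \<open>e x e\<close> exactly when \<open>e\<close> fixes it on both sides.
\<close>

definition corner :: "('a, 'm) ring_scheme \<Rightarrow> 'a \<Rightarrow> ('a, 'm) ring_scheme" where
  "corner R e = R\<lparr>carrier := {x \<in> carrier R. e \<otimes>\<^bsub>R\<^esub> x = x \<and> x \<otimes>\<^bsub>R\<^esub> e = x}, one := e\<rparr>"

lemma corner_simps [simp]:
  "mult (corner R e) = mult R" "add (corner R e) = add R" "zero (corner R e) = zero R"
  "one (corner R e) = e"
  by (simp_all add: corner_def)

lemma mem_corner: "x \<in> carrier (corner R e) \<longleftrightarrow>
    x \<in> carrier R \<and> e \<otimes>\<^bsub>R\<^esub> x = x \<and> x \<otimes>\<^bsub>R\<^esub> e = x"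
  by (simp add: corner_def)

context nonunital_ring
begin

lemma corner_ring:
  assumes e: "e \<in> carrier R" "e \<otimes> e = e"
  shows "ring (corner R e)"
proof (rule ringI)
  show "abelian_group (corner R e)"
  proof (rule abelian_groupI, goal_cases)
    case (6 x)
    then show ?case
      by (intro bexI[of _ "\<ominus> x"])
        (use e in \<open>auto simp: mem_corner l_neg mult_minus_left mult_minus_right\<close>)
  qed (use e in \<open>auto simp: mem_corner left_distrib right_distrib zero_mult mult_zero a_ac\<close>)
  show "monoid (corner R e)"
  proof
    fix x y assume "x \<in> carrier (corner R e)" "y \<in> carrier (corner R e)"
    then show "x \<otimes>\<^bsub>corner R e\<^esub> y \<in> carrier (corner R e)"
      using e by (simp add: mem_corner mult_closed mult_assoc[symmetric]) (simp add: mult_assoc)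
  qed (use e in \<open>auto simp: mem_corner mult_assoc\<close>)
qed (auto simp: mem_corner left_distrib right_distrib)

lemma corner_minus:
  assumes e: "e \<in> carrier R" "e \<otimes> e = e" and x: "x \<in> carrier (corner R e)"
  shows "\<ominus>\<^bsub>corner R e\<^esub> x = \<ominus> x"
proof -
  interpret C: ring "corner R e" using e by (rule corner_ring)
  have "\<ominus> x \<in> carrier (corner R e)"
    using x e by (auto simp: mem_corner mult_minus_left mult_minus_right)
  then show ?thesis using x by (intro C.minus_equality) (auto simp: mem_corner l_neg)
qed

lemma corner_diff:
  assumes "e \<in> carrier R" "e \<otimes> e = e" "y \<in> carrier (corner R e)"
  shows "x \<ominus>\<^bsub>corner R e\<^esub> y = x \<ominus> y"
  using corner_minus[OF assms] by (simp add: a_minus_def)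

lemma corner_memI:
  assumes "e \<in> carrier R" "e \<otimes> e = e" "x \<in> carrier R"
  shows "e \<otimes> x \<otimes> e \<in> carrier (corner R e)"
proof -
  have "e \<otimes> (e \<otimes> x \<otimes> e) = (e \<otimes> e) \<otimes> x \<otimes> e" "e \<otimes> x \<otimes> e \<otimes> e = e \<otimes> x \<otimes> (e \<otimes> e)"
    using assms(1,3) by (simp_all add: mult_assoc mult_closed)
  then show ?thesis using assms by (simp add: mem_corner mult_closed)
qed

end

section \<open>Corners of purely infinite rings have no division ring quotients\<close>

locale purely_infinite_exchange_ring = nonunital_ring +
  assumes s_unital: "s_unital R"
    and purely_infinite: "purely_infinite R"
    and exchange: "exchange_ring R"
begin

text \<open>
  In a purely infinite ring the ideal \<open>RaR\<close> consists of single sandwiches, so this set replaces the set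
  of finite sums.
\<close>

definition sandwiches :: "'a \<Rightarrow> 'a set" where
  "sandwiches a = {x \<otimes> a \<otimes> y | x y. x \<in> carrier R \<and> y \<in> carrier R}"

lemma sandwiches_memI: "x \<in> carrier R \<Longrightarrow> y \<in> carrier R \<Longrightarrow> x \<otimes> a \<otimes> y \<in> sandwiches a"
  by (auto simp: sandwiches_def)

lemma sandwiches_closed: "a \<in> carrier R \<Longrightarrow> sandwiches a \<subseteq> carrier R"
  by (auto simp: sandwiches_def mult_closed)

lemma sandwiches_add:
  assumes a: "a \<in> carrier R" and u: "u \<in> sandwiches a" and v: "v \<in> sandwiches a"
  shows "u \<oplus> v \<in> sandwiches a"
proof -
  obtain x y where 1: "x \<in> carrier R" "y \<in> carrier R" "u = x \<otimes> a \<otimes> y"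
    using u by (auto simp: sandwiches_def)
  obtain x' y' where 2: "x' \<in> carrier R" "y' \<in> carrier R" "v = x' \<otimes> a \<otimes> y'"
    using v by (auto simp: sandwiches_def)
  define r where "r = (\<lambda>i::nat. if i = 0 then x else x')"
  define s where "s = (\<lambda>i::nat. if i = 0 then y else y')"
  have rs: "r \<in> {..<2} \<rightarrow> carrier R" "s \<in> {..<2} \<rightarrow> carrier R"
    using 1 2 by (auto simp: r_def s_def)
  have "(\<Oplus>i\<in>{..<2}. r i \<otimes> a \<otimes> s i) = u \<oplus> v"
    using 1 2 a by (simp add: numeral_2_eq_2 lessThan_Suc r_def s_def mult_closed a_comm)
  then have "u \<oplus> v \<in> sandwich_sums R a"
    using rs unfolding sandwich_sums_def by (intro CollectI exI[of _ 2] exI[of _ r] exI[of _ s]) simp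
  then have "\<exists>p\<in>carrier R. \<exists>q\<in>carrier R. u \<oplus> v = p \<otimes> a \<otimes> q"
    using purely_infinite a unfolding purely_infinite_def by simp
  then show ?thesis by (auto simp: sandwiches_def)
qed

lemma sandwiches_zero: "a \<in> carrier R \<Longrightarrow> \<zero> \<in> sandwiches a"
  using sandwiches_memI[OF zero_closed zero_closed, of a] by (simp add: mult_zero zero_mult)

lemma sandwiches_finsum:
  assumes a: "a \<in> carrier R" and "finite A" and "\<And>i. i \<in> A \<Longrightarrow> f i \<in> sandwiches a"
  shows "finsum R f A \<in> sandwiches a"
  using assms(2,3)
proof (induction A rule: finite_induct)
  case empty
  then show ?case using sandwiches_zero[OF a] by simp
next
  case (insert i A)
  then have "f \<in> insert i A \<rightarrow> carrier R" using sandwiches_closed[OF a] by blast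
  then show ?case using insert sandwiches_add[OF a] by simp
qed

text \<open>
  For a contradiction, \<open>J\<close> is an ideal of the corner \<open>eRe\<close> whose quotient is a division ring.
\<close>

context
  fixes e J
  assumes e: "e \<in> carrier R" "e \<otimes> e = e"
    and J: "ideal J (corner R e)" "e \<notin> J"
    and division: "\<And>a. a \<in> carrier (corner R e) - J \<Longrightarrow>
      \<exists>b\<in>carrier (corner R e). a \<otimes> b \<ominus> e \<in> J \<and> b \<otimes> a \<ominus> e \<in> J"
begin

lemma corner_ideal_closed:
  assumes "a \<in> J"
  shows "a \<in> carrier (corner R e)"
    and "b \<in> J \<Longrightarrow> a \<oplus> b \<in> J" and "b \<in> J \<Longrightarrow> a \<ominus> b \<in> J" and "\<ominus> a \<in> J"
    and "x \<in> carrier (corner R e) \<Longrightarrow> x \<otimes> a \<in> J"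
    and "x \<in> carrier (corner R e) \<Longrightarrow> a \<otimes> x \<in> J"
proof -
  interpret J: ideal J "corner R e" by (rule J(1))
  note subgroup = J.is_additive_subgroup
  show c: "a \<in> carrier (corner R e)" using assms by simp
  have minus: "\<ominus> a \<in> J" if "a \<in> J" for a
    using additive_subgroup.a_inv_closed[OF subgroup that] corner_minus[OF e J.a_Hcarr[OF that]] by simp
  show "\<ominus> a \<in> J" using minus[OF assms] .
  show "b \<in> J \<Longrightarrow> a \<oplus> b \<in> J" using additive_subgroup.a_closed[OF subgroup, of a b] assms by simp
  show "b \<in> J \<Longrightarrow> a \<ominus> b \<in> J" using additive_subgroup.a_closed[OF subgroup, of a "\<ominus> b"] minus[of b] assms by (simp add: minus_eq)
  show "x \<in> carrier (corner R e) \<Longrightarrow> x \<otimes> a \<in> J" using J.I_l_closed[of a x] assms by simp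
  show "x \<in> carrier (corner R e) \<Longrightarrow> a \<otimes> x \<in> J" using J.I_r_closed[of a x] assms by simp
qed

lemma corner_zero_in_ideal: "\<zero> \<in> J"
proof -
  interpret J: ideal J "corner R e" by (rule J(1))
  show ?thesis using additive_subgroup.zero_closed[OF J.is_additive_subgroup] by simp
qed

text \<open>
  Suppose that \<open>u v \<notin> J\<close> and rescale \<open>u\<close> to \<open>y\<close> with \<open>y v \<equiv> e\<close>.  The element \<open>e + v y\<close> lies in \<open>ReR\<close>,
  so it factors as \<open>p e q\<close>.  Compressing it by the row entries \<open>e, y\<close> and the column entries \<open>e, v\<close>
  gives a matrix congruent to the \<open>2 \<times> 2\<close> identity matrix, while the factorisation
  writes it as a column times a row over \<open>eRe/J\<close>; this is impossible over a division ring.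
\<close>

lemma off_diagonal_product_in_ideal:
  assumes u: "u \<in> carrier R" "e \<otimes> u = u" "u \<otimes> e = \<zero>"
    and v: "v \<in> carrier R" "v \<otimes> e = v" "e \<otimes> v = \<zero>"
  shows "u \<otimes> v \<in> J"
proof (rule ccontr)
  assume notin: "u \<otimes> v \<notin> J"
  have "e \<otimes> (u \<otimes> v) = (e \<otimes> u) \<otimes> v" "u \<otimes> v \<otimes> e = u \<otimes> (v \<otimes> e)"
    using u(1) v(1) e(1) by (simp_all add: mult_assoc)
  then have uv: "u \<otimes> v \<in> carrier (corner R e)" using u v by (simp add: mem_corner mult_closed)
  obtain b where b: "b \<in> carrier (corner R e)" "b \<otimes> (u \<otimes> v) \<ominus> e \<in> J"
    using division uv notin by blast
  define y where "y = b \<otimes> u"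
  have bc: "b \<in> carrier R" "e \<otimes> b = b" using b by (auto simp: mem_corner)
  have y: "y \<in> carrier R" "e \<otimes> y = y" "y \<otimes> e = \<zero>"
  proof -
    show "y \<in> carrier R" using bc u by (simp add: y_def mult_closed)
    have "e \<otimes> y = (e \<otimes> b) \<otimes> u" using bc(1) u(1) e(1) by (simp add: y_def mult_assoc)
    then show "e \<otimes> y = y" by (simp add: bc(2) y_def)
    have "y \<otimes> e = b \<otimes> (u \<otimes> e)" using bc(1) u(1) e(1) by (simp add: y_def mult_assoc)
    then show "y \<otimes> e = \<zero>" by (simp add: u(3) mult_zero bc)
  qed
  define n where "n = y \<otimes> v"
  have n: "n \<in> carrier (corner R e)" "n \<ominus> e \<in> J"
  proof -
    have "e \<otimes> n = (e \<otimes> y) \<otimes> v" "n \<otimes> e = y \<otimes> (v \<otimes> e)"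
      using y(1) v(1) e(1) by (simp_all add: n_def mult_assoc)
    then show "n \<in> carrier (corner R e)" using y v by (simp add: mem_corner mult_closed n_def)
    show "n \<ominus> e \<in> J" using b(2) bc u v by (simp add: n_def y_def mult_assoc)
  qed
  have nc: "n \<in> carrier R" using n by (simp add: mem_corner)
  have "e \<otimes> e \<otimes> e \<oplus> v \<otimes> e \<otimes> y \<in> sandwiches e"
    using e v y by (intro sandwiches_add sandwiches_memI) auto
  then have "e \<oplus> v \<otimes> y \<in> sandwiches e" using e v by simp
  then obtain p q where pq: "p \<in> carrier R" "q \<in> carrier R" "p \<otimes> e \<otimes> q = e \<oplus> v \<otimes> y"
    unfolding sandwiches_def by force
  have product: "(z \<otimes> p \<otimes> e) \<otimes> (e \<otimes> q \<otimes> w) = z \<otimes> e \<otimes> w \<oplus> (z \<otimes> v) \<otimes> (y \<otimes> w)"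
    if zw: "z \<in> carrier R" "w \<in> carrier R" for z w
  proof -
    have "(z \<otimes> p \<otimes> e) \<otimes> (e \<otimes> q \<otimes> w) = z \<otimes> (p \<otimes> (e \<otimes> e) \<otimes> q) \<otimes> w"
      using pq(1,2) e(1) zw by (simp add: mult_assoc mult_closed)
    also have "\<dots> = z \<otimes> (e \<oplus> v \<otimes> y) \<otimes> w" unfolding e(2) pq(3) ..
    also have "\<dots> = z \<otimes> e \<otimes> w \<oplus> (z \<otimes> v) \<otimes> (y \<otimes> w)"
      using zw e(1) v(1) y(1) by (simp add: mult_assoc mult_closed left_distrib right_distrib)
    finally show ?thesis .
  qed
  define A where "A = e \<otimes> p \<otimes> e"
  define B' where "B' = e \<otimes> q \<otimes> v"
  define A' where "A' = y \<otimes> p \<otimes> e"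
  have A: "A \<in> carrier (corner R e)" unfolding A_def using e pq by (intro corner_memI)
  have A': "A' \<in> carrier (corner R e)"
  proof -
    have "e \<otimes> A' = (e \<otimes> y) \<otimes> p \<otimes> e" "A' \<otimes> e = y \<otimes> p \<otimes> (e \<otimes> e)"
      using y(1) pq e(1) by (simp_all add: A'_def mult_assoc mult_closed)
    then show ?thesis using y e pq by (simp add: mem_corner mult_closed A'_def)
  qed
  have B': "B' \<in> carrier (corner R e)"
  proof -
    have "e \<otimes> B' = (e \<otimes> e) \<otimes> q \<otimes> v" "B' \<otimes> e = e \<otimes> q \<otimes> (v \<otimes> e)"
      using v(1) pq e(1) by (simp_all add: B'_def mult_assoc mult_closed)
    then show ?thesis using v e pq by (simp add: mem_corner mult_closed B'_def)
  qed
  have AB: "A \<otimes> (e \<otimes> q \<otimes> e) = e"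
    unfolding A_def product[OF e(1) e(1)] using e v y by (simp add: zero_mult)
  have AB': "A \<otimes> B' = \<zero>"
    unfolding A_def B'_def product[OF e(1) v(1)] using e v y by (simp add: zero_mult mult_closed)
  have A'B': "A' \<otimes> B' = n \<otimes> n"
    unfolding A'_def B'_def product[OF y(1) v(1)] using e v y by (simp add: zero_mult mult_closed n_def)
  \<comment> \<open>\<open>A\<close> is invertible modulo \<open>J\<close> and kills \<open>B'\<close>, so \<open>B'\<close> and with it the entry \<open>n n\<close> vanish modulo \<open>J\<close>.\<close>
  have "A \<notin> J"
    using AB corner_ideal_closed(6)[of A "e \<otimes> q \<otimes> e"] corner_memI[OF e pq(2)] J(2) by auto
  then obtain c where c: "c \<in> carrier (corner R e)" "c \<otimes> A \<ominus> e \<in> J"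
    using division A by blast
  have carr: "c \<in> carrier R" "A \<in> carrier R" "B' \<in> carrier R" and eB: "e \<otimes> B' = B'"
    using c A B' by (simp_all add: mem_corner)
  have "(c \<otimes> A \<ominus> e) \<otimes> B' = c \<otimes> (A \<otimes> B') \<ominus> e \<otimes> B'" using carr e(1) by algebra
  also have "\<dots> = \<ominus> B'" unfolding AB' eB using carr by (simp add: mult_zero minus_eq)
  finally have "\<ominus> B' \<in> J" using corner_ideal_closed(6)[OF c(2) B'] by simp
  then have "B' \<in> J" using corner_ideal_closed(4)[of "\<ominus> B'"] carr by simp
  then have nn: "n \<otimes> n \<in> J" using corner_ideal_closed(5)[of B' A'] A' A'B' by simp
  have en: "e \<otimes> n = n" using n by (simp add: mem_corner)
  have "n \<otimes> n \<ominus> (n \<ominus> e) \<otimes> n \<in> J"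
    using nn corner_ideal_closed(6)[OF n(2) n(1)] corner_ideal_closed(3) by blast
  moreover have "n \<otimes> n \<ominus> (n \<ominus> e) \<otimes> n = e \<otimes> n" using nc e(1) by algebra
  ultimately have "n \<in> J" using en by simp
  then have "n \<ominus> (n \<ominus> e) \<in> J" using n(2) corner_ideal_closed(3) by blast
  moreover have "n \<ominus> (n \<ominus> e) = e" using nc e(1) by algebra
  ultimately show False using J(2) by simp
qed

text \<open>
  Inserting \<open>1 = e + (1 - e)\<close> between \<open>x\<close> and \<open>y\<close> leaves the error term \<open>e x (1 - e) \<otimes> (1 - e) y e\<close>, an
  off-diagonal product.
\<close>

lemma corner_compression_multiplicative:
  assumes x: "x \<in> carrier R" and y: "y \<in> carrier R"
  shows "\<exists>j\<in>J. e \<otimes> (x \<otimes> y) \<otimes> e = (e \<otimes> x \<otimes> e) \<otimes> (e \<otimes> y \<otimes> e) \<oplus> j"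
proof -
  define u where "u = e \<otimes> x \<ominus> e \<otimes> x \<otimes> e"
  define v where "v = y \<otimes> e \<ominus> e \<otimes> y \<otimes> e"
  have ee: "e \<otimes> (e \<otimes> z) = e \<otimes> z" if "z \<in> carrier R" for z
    using that e by (simp add: mult_assoc[symmetric])
  note simps = mult_assoc mult_closed left_distrib right_distrib minus_eq mult_minus_left
    mult_minus_right e ee r_neg l_neg
  have u: "u \<in> carrier R" "e \<otimes> u = u" "u \<otimes> e = \<zero>"
    using x by (simp_all add: u_def simps)
  have v: "v \<in> carrier R" "v \<otimes> e = v" "e \<otimes> v = \<zero>"
    using y by (simp_all add: v_def simps)
  have "e \<otimes> (x \<otimes> y) \<otimes> e = (e \<otimes> x \<otimes> e) \<otimes> (y \<otimes> e) \<oplus> u \<otimes> (y \<otimes> e)"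
    unfolding u_def using x y e(1) by algebra
  also have "u \<otimes> (y \<otimes> e) = u \<otimes> v \<oplus> (u \<otimes> e) \<otimes> (y \<otimes> e)"
    unfolding v_def using u(1) y e(1) by algebra
  also have "\<dots> = u \<otimes> v" unfolding u(3) using u v y e by (simp add: zero_mult mult_closed)
  also have "(e \<otimes> x \<otimes> e) \<otimes> (y \<otimes> e) = (e \<otimes> x \<otimes> e) \<otimes> (e \<otimes> y \<otimes> e)"
    using x y by (simp add: simps)
  finally show ?thesis using off_diagonal_product_in_ideal[OF u v] by blast
qed

text \<open>
  The compression \<open>r \<mapsto> e r e\<close> induces a surjective ring homomorphism from \<open>R\<close> to \<open>eRe/J\<close>.  Its kernel is
  an ideal of \<open>R\<close> with a division ring as quotient.
\<close>

lemma corner_without_division_quotient: False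
proof -
  let ?K = "{r \<in> carrier R. e \<otimes> r \<otimes> e \<in> J}"
  have ee: "e \<otimes> (e \<otimes> z) = e \<otimes> z" if "z \<in> carrier R" for z
    using that e by (simp add: mult_assoc[symmetric])
  note simps = mult_assoc mult_closed left_distrib right_distrib minus_eq mult_minus_left
    mult_minus_right e ee r_neg l_neg
  have K: "two_sided_ideal ?K R"
    unfolding two_sided_ideal_def
  proof (intro conjI ballI)
    show "additive_subgroup ?K R"
    proof (intro additive_subgroupI add.subgroupI)
      show "?K \<noteq> {}" using corner_zero_in_ideal e zero_closed by (auto simp: mult_zero zero_mult)
    next
      fix a assume "a \<in> ?K"
      then show "\<ominus> a \<in> ?K"
        using corner_ideal_closed(4)[of "e \<otimes> a \<otimes> e"] e
        by (simp add: mult_minus_left mult_minus_right mult_closed)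
    next
      fix a b assume "a \<in> ?K" "b \<in> ?K"
      then show "a \<oplus> b \<in> ?K"
        using corner_ideal_closed(2)[of "e \<otimes> a \<otimes> e" "e \<otimes> b \<otimes> e"] e
        by (simp add: left_distrib right_distrib mult_closed)
    qed auto
  next
    fix a x assume a: "a \<in> ?K" and x: "x \<in> carrier R"
    have c: "e \<otimes> x \<otimes> e \<in> carrier (corner R e)" using e x by (intro corner_memI)
    obtain j where "j \<in> J" "e \<otimes> (x \<otimes> a) \<otimes> e = (e \<otimes> x \<otimes> e) \<otimes> (e \<otimes> a \<otimes> e) \<oplus> j"
      using corner_compression_multiplicative[OF x, of a] a by blast
    then show "x \<otimes> a \<in> ?K"
      using a x corner_ideal_closed(5)[of "e \<otimes> a \<otimes> e", OF _ c] corner_ideal_closed(2) by (simp add: mult_closed)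
    obtain j where "j \<in> J" "e \<otimes> (a \<otimes> x) \<otimes> e = (e \<otimes> a \<otimes> e) \<otimes> (e \<otimes> x \<otimes> e) \<oplus> j"
      using corner_compression_multiplicative[of a x] a x by blast
    then show "a \<otimes> x \<in> ?K"
      using a x corner_ideal_closed(6)[of "e \<otimes> a \<otimes> e", OF _ c] corner_ideal_closed(2) by (simp add: mult_closed)
  qed
  have "is_division_ring (R Quot ?K)"
  proof (rule quotient_is_division_ringI[OF K e(1)])
    show "e \<notin> ?K" using e J by simp
    fix x assume x: "x \<in> carrier R"
    have "e \<otimes> (e \<otimes> x \<ominus> x) \<otimes> e = \<zero>" "e \<otimes> (x \<otimes> e \<ominus> x) \<otimes> e = \<zero>"
      using x by (simp_all add: simps zero_mult)
    then show "e \<otimes> x \<ominus> x \<in> ?K \<and> x \<otimes> e \<ominus> x \<in> ?K"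
      using x e corner_zero_in_ideal by (simp add: mult_closed)
  next
    fix x assume x: "x \<in> carrier R - ?K"
    then have c: "e \<otimes> x \<otimes> e \<in> carrier (corner R e)" "e \<otimes> x \<otimes> e \<notin> J"
      using e by (auto intro: corner_memI)
    obtain b where b: "b \<in> carrier (corner R e)"
      "e \<otimes> x \<otimes> e \<otimes> b \<ominus> e \<in> J" "b \<otimes> (e \<otimes> x \<otimes> e) \<ominus> e \<in> J"
      using division c by blast
    have bc: "b \<in> carrier R" "e \<otimes> b = b" "b \<otimes> e = b" using b by (auto simp: mem_corner)
    have eb: "b \<otimes> (e \<otimes> z) = b \<otimes> z" "e \<otimes> (b \<otimes> z) = b \<otimes> z" if "z \<in> carrier R" for z
      using that e bc by (simp_all add: mult_assoc[symmetric])
    have "e \<otimes> (x \<otimes> b \<ominus> e) \<otimes> e = e \<otimes> x \<otimes> e \<otimes> b \<ominus> e"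
      using x bc by (simp add: simps)
    moreover have "e \<otimes> (b \<otimes> x \<ominus> e) \<otimes> e = b \<otimes> (e \<otimes> x \<otimes> e) \<ominus> e"
      using x bc eb by (simp add: simps)
    ultimately show "\<exists>y\<in>carrier R. x \<otimes> y \<ominus> e \<in> ?K \<and> y \<otimes> x \<ominus> e \<in> ?K"
      using b bc x e by (intro bexI[of _ b]) (simp_all add: mult_closed)
  qed
  then show False using purely_infinite K unfolding purely_infinite_def by blast
qed

end

section \<open>Orthogonal isometries over an idempotent\<close>

text \<open>
  The corner \<open>eRe\<close> inherits the exchange property and pure infiniteness by cutting the witnesses with \<open>e\<close>,
  and it has no division ring quotient, so its identity \<open>e\<close> is properly infinite.
\<close>

lemma idempotent_properly_infinite:
  assumes e: "e \<in> carrier R" "e \<otimes> e = e"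
  obtains \<alpha> \<beta> \<gamma> \<delta> where "{\<alpha>, \<beta>, \<gamma>, \<delta>} \<subseteq> carrier (corner R e)"
    "\<alpha> \<otimes> \<beta> = e" "\<alpha> \<otimes> \<delta> = \<zero>" "\<gamma> \<otimes> \<beta> = \<zero>" "\<gamma> \<otimes> \<delta> = e"
proof -
  interpret C: ring "corner R e" using e by (rule corner_ring)
  have "C.absorbed_by_one \<one>\<^bsub>corner R e\<^esub>"
  proof (rule C.one_properly_infinite)
    show C.exchange
      unfolding C.exchange_def
    proof
      fix x assume x: "x \<in> carrier (corner R e)"
      then have xc: "x \<in> carrier R" "e \<otimes> x = x" "x \<otimes> e = x" by (auto simp: mem_corner)
      obtain h r s where h: "h \<in> carrier R" "r \<in> carrier R" "s \<in> carrier R" "h \<otimes> h = h"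
        and hr: "h = x \<otimes> r" and hs: "h = x \<oplus> s \<ominus> x \<otimes> s"
        using exchange xc(1) unfolding exchange_ring_def by metis
      \<comment> \<open>The witness \<open>h = x r\<close> satisfies \<open>e h = h\<close>; multiplying by \<open>e\<close> on the right moves it into the corner.\<close>
      define g where "g = h \<otimes> e"
      define r' where "r' = e \<otimes> r \<otimes> e"
      define t where "t = e \<ominus> e \<otimes> s \<otimes> e"
      have eh: "e \<otimes> h = h" unfolding hr using e xc h by (simp add: mult_assoc[symmetric])
      have g: "g \<otimes> g = g"
      proof -
        have "g \<otimes> g = h \<otimes> (e \<otimes> h) \<otimes> e" using h(1) e(1) by (simp add: g_def mult_assoc mult_closed)
        then show ?thesis by (simp add: eh h g_def)
      qed
      have gr: "g = x \<otimes> r'"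
      proof -
        have "x \<otimes> r' = (x \<otimes> e) \<otimes> r \<otimes> e" using h(2) xc(1) e(1) by (simp add: r'_def mult_assoc mult_closed)
        then show ?thesis by (simp add: xc g_def hr)
      qed
      have eg: "e \<otimes> g = g" using eh h e by (simp add: g_def mult_assoc[symmetric])
      have "g = e \<otimes> g" by (simp add: eg)
      also have "\<dots> = (e \<otimes> x) \<otimes> e \<oplus> e \<otimes> s \<otimes> e \<ominus> (e \<otimes> x) \<otimes> s \<otimes> e"
        unfolding g_def hs using e(1) xc(1) h(3) by algebra
      also have "\<dots> = x \<oplus> e \<otimes> s \<otimes> e \<ominus> x \<otimes> s \<otimes> e" by (simp add: xc)
      finally have g2: "g = x \<oplus> e \<otimes> s \<otimes> e \<ominus> x \<otimes> s \<otimes> e" .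
      have et: "e \<otimes> (e \<otimes> z) = e \<otimes> z" "x \<otimes> (e \<otimes> z) = x \<otimes> z" if "z \<in> carrier R" for z
        using that e xc by (simp_all add: mult_assoc[symmetric])
      have "(e \<ominus> x) \<otimes> t = e \<otimes> e \<ominus> e \<otimes> (e \<otimes> (s \<otimes> e)) \<ominus> x \<otimes> e \<oplus> x \<otimes> (e \<otimes> (s \<otimes> e))"
        unfolding t_def using e(1) xc(1) h(3) by algebra
      also have "\<dots> = e \<ominus> e \<otimes> (s \<otimes> e) \<ominus> x \<oplus> x \<otimes> (s \<otimes> e)"
        using h e by (simp add: et xc mult_closed)
      also have "\<dots> = e \<ominus> g" unfolding g2 using e(1) xc(1) h(3) by algebra
      finally have gt: "e \<ominus> g = (e \<ominus> x) \<otimes> t" ..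
      have c: "g \<in> carrier (corner R e)" "r' \<in> carrier (corner R e)" "e \<otimes> s \<otimes> e \<in> carrier (corner R e)"
        "e \<in> carrier (corner R e)"
        using e h corner_memI eg by (simp_all add: g_def r'_def mem_corner mult_closed mult_assoc)
      have "t = e \<ominus>\<^bsub>corner R e\<^esub> e \<otimes> s \<otimes> e" by (simp add: corner_diff[OF e c(3)] t_def)
      then have "t \<in> carrier (corner R e)" using C.minus_closed[OF c(4) c(3)] by simp
      then show "\<exists>g\<in>carrier (corner R e). \<exists>r\<in>carrier (corner R e). \<exists>t\<in>carrier (corner R e).
          g \<otimes>\<^bsub>corner R e\<^esub> g = g \<and> g = x \<otimes>\<^bsub>corner R e\<^esub> r \<and>
          \<one>\<^bsub>corner R e\<^esub> \<ominus>\<^bsub>corner R e\<^esub> g = (\<one>\<^bsub>corner R e\<^esub> \<ominus>\<^bsub>corner R e\<^esub> x) \<otimes>\<^bsub>corner R e\<^esub> t"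
        using c g gr gt x
        by (intro bexI[of _ g] bexI[of _ r'] bexI[of _ t]) (simp_all add: corner_diff[OF e])
    qed
  next
    fix a x y x' y' assume A: "{a, x, y, x', y'} \<subseteq> carrier (corner R e)"
    then have a: "a \<in> carrier R" and "e \<otimes> a = a" "a \<otimes> e = a" by (auto simp: mem_corner)
    have "x \<otimes> a \<otimes> y \<oplus> x' \<otimes> a \<otimes> y' \<in> sandwiches a"
      using A by (intro sandwiches_add sandwiches_memI) (auto simp: mem_corner)
    then obtain p q where pq: "p \<in> carrier R" "q \<in> carrier R"
      "x \<otimes> a \<otimes> y \<oplus> x' \<otimes> a \<otimes> y' = p \<otimes> a \<otimes> q"
      by (auto simp: sandwiches_def)
    let ?s = "x \<otimes> a \<otimes> y \<oplus> x' \<otimes> a \<otimes> y'"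
    have "?s \<in> carrier (corner R e)"
      using A C.a_closed[of "x \<otimes> a \<otimes> y" "x' \<otimes> a \<otimes> y'"] C.m_closed[of "x \<otimes> a" y]
        C.m_closed[of "x' \<otimes> a" y'] C.m_closed[of x a] C.m_closed[of x' a]
      by simp
    then have "?s = e \<otimes> (p \<otimes> a \<otimes> q) \<otimes> e" unfolding pq by (simp add: mem_corner)
    also have "\<dots> = e \<otimes> (p \<otimes> (e \<otimes> a \<otimes> e) \<otimes> q) \<otimes> e"
      using \<open>e \<otimes> a = a\<close> \<open>a \<otimes> e = a\<close> by simp
    also have "\<dots> = (e \<otimes> p \<otimes> e) \<otimes> a \<otimes> (e \<otimes> q \<otimes> e)"
      using e(1) pq(1,2) a by (simp add: mult_assoc mult_closed)
    finally show "\<exists>v\<in>carrier (corner R e). \<exists>w\<in>carrier (corner R e).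
        x \<otimes>\<^bsub>corner R e\<^esub> a \<otimes>\<^bsub>corner R e\<^esub> y \<oplus>\<^bsub>corner R e\<^esub> x' \<otimes>\<^bsub>corner R e\<^esub> a \<otimes>\<^bsub>corner R e\<^esub> y' =
        v \<otimes>\<^bsub>corner R e\<^esub> a \<otimes>\<^bsub>corner R e\<^esub> w"
      using corner_memI[OF e pq(1)] corner_memI[OF e pq(2)] by auto
  next
    fix J assume J: "ideal J (corner R e)" "\<one>\<^bsub>corner R e\<^esub> \<notin> J"
    have ec: "e \<in> carrier (corner R e)" using e by (simp add: mem_corner)
    show "\<exists>a\<in>carrier (corner R e) - J. \<forall>b\<in>carrier (corner R e).
        \<not> (a \<otimes>\<^bsub>corner R e\<^esub> b \<ominus>\<^bsub>corner R e\<^esub> \<one>\<^bsub>corner R e\<^esub> \<in> J \<and>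
           b \<otimes>\<^bsub>corner R e\<^esub> a \<ominus>\<^bsub>corner R e\<^esub> \<one>\<^bsub>corner R e\<^esub> \<in> J)"
      using corner_without_division_quotient[OF e J(1)] J(2)
      by (auto simp: corner_diff[OF e ec])
  qed
  then show ?thesis
    by (rule C.absorbed_by_oneE) (rule that, auto)
qed

text \<open>
  One splitting keeps a copy \<open>\<beta>\<alpha>\<close> of \<open>e\<close> free next to \<open>\<delta>\<gamma>\<close>; a family of \<open>m\<close> isometries is pushed into that
  copy and \<open>\<gamma>, \<delta>\<close> become the new first members.
\<close>

lemma idempotent_isometries:
  assumes e: "e \<in> carrier R" "e \<otimes> e = e"
  obtains t s :: "nat \<Rightarrow> 'a" where
    "\<And>i. t i \<in> carrier (corner R e)" "\<And>i. s i \<in> carrier (corner R e)"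
    "\<And>i j. i < m \<Longrightarrow> j < m \<Longrightarrow> t i \<otimes> s j = (if i = j then e else \<zero>)"
proof -
  obtain \<alpha> \<beta> \<gamma> \<delta> where c: "{\<alpha>, \<beta>, \<gamma>, \<delta>} \<subseteq> carrier (corner R e)"
    and rel: "\<alpha> \<otimes> \<beta> = e" "\<alpha> \<otimes> \<delta> = \<zero>" "\<gamma> \<otimes> \<beta> = \<zero>" "\<gamma> \<otimes> \<delta> = e"
    using e by (rule idempotent_properly_infinite)
  interpret C: ring "corner R e" using e by (rule corner_ring)
  have closed: "x \<otimes> y \<in> carrier (corner R e)"
    if "x \<in> carrier (corner R e)" "y \<in> carrier (corner R e)" for x y
    using C.m_closed[OF that] by simp
  have "\<exists>t s. (\<forall>i. t i \<in> carrier (corner R e) \<and> s i \<in> carrier (corner R e)) \<and>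
      (\<forall>i<m. \<forall>j<m. t i \<otimes> s j = (if i = j then e else \<zero>))"
  proof (induction m)
    case 0
    then show ?case using C.zero_closed by auto
  next
    case (Suc m)
    then obtain t s where ts: "\<And>i. t i \<in> carrier (corner R e)" "\<And>i. s i \<in> carrier (corner R e)"
      "\<And>i j. i < m \<Longrightarrow> j < m \<Longrightarrow> t i \<otimes> s j = (if i = j then e else \<zero>)"
      by blast
    let ?t = "case_nat \<gamma> (\<lambda>i. t i \<otimes> \<alpha>)" and ?s = "case_nat \<delta> (\<lambda>j. \<beta> \<otimes> s j)"
    have carr: "\<alpha> \<in> carrier R" "\<beta> \<in> carrier R" "\<gamma> \<in> carrier R" "\<delta> \<in> carrier R"
      "t i \<in> carrier R" "s i \<in> carrier R" "t i \<otimes> e = t i" for i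
      using c ts(1,2)[of i] by (auto simp: mem_corner)
    have product: "?t i \<otimes> ?s j = (if i = j then e else \<zero>)" if "i < Suc m" "j < Suc m" for i j
    proof (cases i; cases j)
      fix i' j' assume ij: "i = Suc i'" "j = Suc j'"
      have "t i' \<otimes> \<alpha> \<otimes> (\<beta> \<otimes> s j') = t i' \<otimes> (\<alpha> \<otimes> \<beta>) \<otimes> s j'"
        using carr by (simp add: mult_assoc mult_closed)
      then show ?thesis using ij that ts(3)[of i' j'] by (simp add: rel carr)
    next
      fix i' assume ij: "i = Suc i'" "j = 0"
      have "t i' \<otimes> \<alpha> \<otimes> \<delta> = t i' \<otimes> (\<alpha> \<otimes> \<delta>)" using carr by (simp add: mult_assoc)
      then show ?thesis using ij carr by (simp add: rel mult_zero)
    next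
      fix j' assume ij: "i = 0" "j = Suc j'"
      have "\<gamma> \<otimes> (\<beta> \<otimes> s j') = (\<gamma> \<otimes> \<beta>) \<otimes> s j'" using carr by (simp add: mult_assoc)
      then show ?thesis using ij carr by (simp add: rel zero_mult)
    qed (simp add: rel)
    have mem: "?t i \<in> carrier (corner R e)" "?s i \<in> carrier (corner R e)" for i
      using c ts closed by (auto split: nat.split)
    show ?case
      by (rule exI[of _ ?t], rule exI[of _ ?s], intro conjI allI impI)
        (rule mem, rule mem, rule product)
  qed
  then obtain t s where "\<forall>i. t i \<in> carrier (corner R e) \<and> s i \<in> carrier (corner R e)"
    "\<forall>i<m. \<forall>j<m. t i \<otimes> s j = (if i = j then e else \<zero>)"
    by (elim exE conjE)
  then show ?thesis by (intro that[of t s]) simp_all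
qed

section \<open>Common local units\<close>

text \<open>
  If \<open>v\<close> fixes \<open>F\<close> and \<open>w\<close> fixes \<open>a - a v\<close>, then \<open>v + w - v w\<close> fixes both \<open>F\<close> and \<open>a\<close>.
\<close>

lemma common_right_unit:
  "finite F \<Longrightarrow> F \<subseteq> carrier R \<Longrightarrow> \<exists>v\<in>carrier R. \<forall>x\<in>F. x \<otimes> v = x"
proof (induction F rule: finite_induct)
  case empty
  then show ?case using zero_closed by blast
next
  case (insert a F)
  then obtain v where v: "v \<in> carrier R" "\<And>x. x \<in> F \<Longrightarrow> x \<otimes> v = x" by auto
  have a: "a \<in> carrier R" "a \<ominus> a \<otimes> v \<in> carrier R" using insert.prems v by (auto simp: mult_closed)
  obtain w where w: "w \<in> carrier R" "(a \<ominus> a \<otimes> v) \<otimes> w = a \<ominus> a \<otimes> v"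
    using s_unital a unfolding s_unital_def by metis
  let ?v = "v \<oplus> w \<ominus> v \<otimes> w"
  have eq: "x \<otimes> ?v = x \<otimes> v \<oplus> (x \<ominus> x \<otimes> v) \<otimes> w" if "x \<in> carrier R" for x
    using that v(1) w(1) by algebra
  have "a \<otimes> ?v = a \<otimes> v \<oplus> (a \<ominus> a \<otimes> v)" by (simp add: eq a w)
  also have "\<dots> = a" using a(1) v(1) by algebra
  finally have "a \<otimes> ?v = a" .
  moreover have "x \<otimes> ?v = x" if x: "x \<in> F" for x
  proof -
    have "x \<in> carrier R" using x insert.prems by auto
    then show ?thesis
      unfolding eq[OF \<open>x \<in> carrier R\<close>] v(2)[OF x] using w by (simp add: minus_eq r_neg zero_mult)
  qed
  moreover have "?v \<in> carrier R" using v w by (simp add: mult_closed)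
  ultimately show ?case by blast
qed

lemma common_left_unit:
  "finite F \<Longrightarrow> F \<subseteq> carrier R \<Longrightarrow> \<exists>u\<in>carrier R. \<forall>x\<in>F. u \<otimes> x = x"
proof (induction F rule: finite_induct)
  case empty
  then show ?case using zero_closed by blast
next
  case (insert a F)
  then obtain v where v: "v \<in> carrier R" "\<And>x. x \<in> F \<Longrightarrow> v \<otimes> x = x" by auto
  have a: "a \<in> carrier R" "a \<ominus> v \<otimes> a \<in> carrier R" using insert.prems v by (auto simp: mult_closed)
  obtain w where w: "w \<in> carrier R" "w \<otimes> (a \<ominus> v \<otimes> a) = a \<ominus> v \<otimes> a"
    using s_unital a unfolding s_unital_def by metis
  let ?v = "v \<oplus> w \<ominus> w \<otimes> v"
  have eq: "?v \<otimes> x = v \<otimes> x \<oplus> w \<otimes> (x \<ominus> v \<otimes> x)" if "x \<in> carrier R" for x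
    using that v(1) w(1) by algebra
  have "?v \<otimes> a = v \<otimes> a \<oplus> (a \<ominus> v \<otimes> a)" by (simp add: eq a w)
  also have "\<dots> = a" using a(1) v(1) by algebra
  finally have "?v \<otimes> a = a" .
  moreover have "?v \<otimes> x = x" if x: "x \<in> F" for x
  proof -
    have "x \<in> carrier R" using x insert.prems by auto
    then show ?thesis
      unfolding eq[OF \<open>x \<in> carrier R\<close>] v(2)[OF x] using w by (simp add: minus_eq r_neg mult_zero)
  qed
  moreover have "?v \<in> carrier R" using v w by (simp add: mult_closed)
  ultimately show ?case by blast
qed

text \<open>
  The exchange idempotent of a right unit \<open>v\<close> has the form \<open>v + s - v s\<close>, and \<open>x v = x\<close> cancels the last two
  terms in \<open>x (v + s - v s)\<close>.  The exchange condition is one-sided, so this does not yield idempotent left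
  units.
\<close>

lemma common_right_idempotent:
  assumes "finite F" "F \<subseteq> carrier R"
  obtains e where "e \<in> carrier R" "e \<otimes> e = e" "\<And>x. x \<in> F \<Longrightarrow> x \<otimes> e = x"
proof -
  obtain v where v: "v \<in> carrier R" "\<And>x. x \<in> F \<Longrightarrow> x \<otimes> v = x"
    using common_right_unit[OF assms] by blast
  obtain e r s where e: "e \<in> carrier R" "r \<in> carrier R" "s \<in> carrier R" "e \<otimes> e = e"
    and es: "e = v \<oplus> s \<ominus> v \<otimes> s"
    using exchange v(1) unfolding exchange_ring_def by metis
  have "x \<otimes> e = x" if x: "x \<in> F" for x
  proof -
    have xc: "x \<in> carrier R" using x assms by auto
    have "x \<otimes> e = x \<otimes> v \<oplus> x \<otimes> s \<ominus> (x \<otimes> v) \<otimes> s"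
      unfolding es using xc v(1) e(3) by algebra
    also have "\<dots> = x" unfolding v(2)[OF x] using xc e(3) by algebra
    finally show ?thesis .
  qed
  then show ?thesis using that e by blast
qed

section \<open>Compressing arrays of elements\<close>

lemma finsum_only_nonzero:
  assumes "i < (m::nat)" "f i \<in> carrier R" "\<And>j. j < m \<Longrightarrow> j \<noteq> i \<Longrightarrow> f j = \<zero>"
  shows "finsum R f {..<m} = f i"
proof -
  have c: "f j \<in> carrier R" if "j < m" for j using assms that by (cases "j = i") auto
  have "finsum R f {..<m} = (\<Oplus>j\<in>{..<m}. if i = j then f j else \<zero>)"
    using assms c by (intro finsum_cong') auto
  also have "\<dots> = f i" using assms(1) c by (intro add.finprod_singleton) auto
  finally show ?thesis .
qed

text \<open>
  The compressed element is \<open>\<Sum> s\<^sub>p a\<^sub>p\<^sub>q t'\<^sub>q\<close> with isometries \<open>s\<^sub>p\<close> over an idempotent \<open>f\<close> and \<open>t'\<^sub>q\<close> over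
  an idempotent \<open>e\<close>; multiplying by \<open>t\<^sub>i\<close> and \<open>s'\<^sub>j\<close> isolates \<open>f a\<^sub>i\<^sub>j e\<close>.  On the right \<open>e\<close> can be chosen
  to fix all entries.  On the left a right idempotent \<open>f\<close> for a common left unit \<open>u\<close> of the entries
  suffices, because \<open>u f a\<^sub>i\<^sub>j = u a\<^sub>i\<^sub>j = a\<^sub>i\<^sub>j\<close>.
\<close>

lemma compress_array:
  fixes a :: "nat \<Rightarrow> nat \<Rightarrow> 'a"
  assumes a: "\<And>i j. i < m \<Longrightarrow> j < m \<Longrightarrow> a i j \<in> carrier R"
  obtains x y w z :: "nat \<Rightarrow> 'a" where
    "\<And>i. {x i, y i, w i, z i} \<subseteq> carrier R"
    "\<And>i j. i < m \<Longrightarrow> j < m \<Longrightarrow>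
       x i \<otimes> (\<Oplus>p\<in>{..<m}. \<Oplus>q\<in>{..<m}. y p \<otimes> a p q \<otimes> w q) \<otimes> z j = a i j"
proof -
  let ?F = "(\<lambda>(i, j). a i j) ` ({..<m} \<times> {..<m})"
  have F: "finite ?F" "?F \<subseteq> carrier R" using a by auto
  obtain u where u: "u \<in> carrier R" "\<And>i j. i < m \<Longrightarrow> j < m \<Longrightarrow> u \<otimes> a i j = a i j"
    using common_left_unit[OF F] by auto
  obtain f where f: "f \<in> carrier R" "f \<otimes> f = f" "u \<otimes> f = u"
    using common_right_idempotent[of "{u}"] u(1) by auto
  obtain e where e: "e \<in> carrier R" "e \<otimes> e = e" "\<And>x. x \<in> ?F \<Longrightarrow> x \<otimes> e = x"
    using common_right_idempotent[OF F] by blast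
  have ae: "a i j \<otimes> e = a i j" if "i < m" "j < m" for i j using e(3)[of "a i j"] that by auto
  obtain t s where ts: "\<And>i. t i \<in> carrier (corner R f)" "\<And>i. s i \<in> carrier (corner R f)"
    "\<And>i j. i < m \<Longrightarrow> j < m \<Longrightarrow> t i \<otimes> s j = (if i = j then f else \<zero>)"
    using idempotent_isometries[OF f(1,2), where m = m] by blast
  obtain t' s' where ts': "\<And>i. t' i \<in> carrier (corner R e)" "\<And>i. s' i \<in> carrier (corner R e)"
    "\<And>i j. i < m \<Longrightarrow> j < m \<Longrightarrow> t' i \<otimes> s' j = (if i = j then e else \<zero>)"
    using idempotent_isometries[OF e(1,2), where m = m] by blast
  have c: "t i \<in> carrier R" "s i \<in> carrier R" "t' i \<in> carrier R" "s' i \<in> carrier R" for i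
    using ts(1,2)[of i] ts'(1,2)[of i] by (auto simp: mem_corner)
  have summand: "u \<otimes> t i \<otimes> (s p \<otimes> a p q \<otimes> t' q) \<otimes> s' j = (if p = i \<and> q = j then a i j else \<zero>)"
    if "i < m" "j < m" "p < m" "q < m" for i j p q
  proof -
    have "u \<otimes> t i \<otimes> (s p \<otimes> a p q \<otimes> t' q) \<otimes> s' j = u \<otimes> (t i \<otimes> s p) \<otimes> a p q \<otimes> (t' q \<otimes> s' j)"
      using u(1) c a that by (simp add: mult_assoc mult_closed)
    also have "\<dots> = (if p = i \<and> q = j then a i j else \<zero>)"
      using that u f(1,3) e(1) a ae by (simp add: ts(3) ts'(3) mult_zero zero_mult mult_closed)
    finally show ?thesis .
  qed
  let ?sum = "\<lambda>p. \<Oplus>q\<in>{..<m}. s p \<otimes> a p q \<otimes> t' q"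
  have "u \<otimes> t i \<otimes> (\<Oplus>p\<in>{..<m}. ?sum p) \<otimes> s' j = a i j" if ij: "i < m" "j < m" for i j
  proof -
    have "u \<otimes> t i \<otimes> (\<Oplus>p\<in>{..<m}. ?sum p) \<otimes> s' j = (\<Oplus>p\<in>{..<m}. u \<otimes> t i \<otimes> ?sum p \<otimes> s' j)"
      using u(1) c a
      by (simp add: finsum_left_mult finsum_right_mult mult_closed finsum_closed Pi_def)
    also have "\<dots> = (\<Oplus>p\<in>{..<m}. \<Oplus>q\<in>{..<m}. u \<otimes> t i \<otimes> (s p \<otimes> a p q \<otimes> t' q) \<otimes> s' j)"
      using u(1) c a
      by (intro finsum_cong') (simp_all add: finsum_left_mult finsum_right_mult mult_closed finsum_closed Pi_def)
    also have "\<dots> = (\<Oplus>p\<in>{..<m}. \<Oplus>q\<in>{..<m}. if p = i \<and> q = j then a i j else \<zero>)"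
      using ij a by (intro finsum_cong') (auto simp: summand intro!: finsum_cong' finsum_closed)
    also have "\<dots> = (\<Oplus>q\<in>{..<m}. if i = i \<and> q = j then a i j else \<zero>)"
      using ij a by (intro finsum_only_nonzero) (auto intro!: finsum_closed)
    also have "\<dots> = a i j"
      using ij a finsum_only_nonzero[of j m "\<lambda>q. if q = j then a i j else \<zero>"] by simp
    finally show ?thesis .
  qed
  then show ?thesis
    using u(1) c by (intro that[of "\<lambda>i. u \<otimes> t i" s t' s']) (auto simp: mult_closed)
qed

text \<open>
  Compressing \<open>diag(a, a)\<close> gives an element of \<open>RaR\<close>, which is \<open>g a h\<close> for some \<open>g, h\<close>; recovering the
  entries of the array from it exhibits \<open>a\<close> as properly infinite.
\<close>

lemma nonzero_properly_infinite:
  assumes a: "a \<in> carrier R" "a \<noteq> \<zero>"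
  shows "properly_infinite R a"
proof -
  \<comment> \<open>The array has size three so that the indices \<open>1\<close> and \<open>2\<close> of \<open>properly_infinite\<close> can be used directly.\<close>
  define d where "d p q = (if p = q then a else \<zero>)" for p q :: nat
  have d: "d p q \<in> carrier R" for p q using a by (simp add: d_def)
  obtain x y w z :: "nat \<Rightarrow> 'a" where c: "\<And>i. {x i, y i, w i, z i} \<subseteq> carrier R"
    and eq: "\<And>i j. i < 3 \<Longrightarrow> j < 3 \<Longrightarrow>
       x i \<otimes> (\<Oplus>p\<in>{..<3}. \<Oplus>q\<in>{..<3}. y p \<otimes> d p q \<otimes> w q) \<otimes> z j = d i j"
    using compress_array[of 3 d] d by blast
  have "y p \<otimes> d p q \<otimes> w q \<in> sandwiches a" for p q
    using c[of p] c[of q] a sandwiches_memI[of "y p" "w q" a] sandwiches_zero[OF a(1)]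
    by (auto simp: d_def mult_zero zero_mult)
  then have "(\<Oplus>p\<in>{..<3}. \<Oplus>q\<in>{..<3}. y p \<otimes> d p q \<otimes> w q) \<in> sandwiches a"
    using a by (intro sandwiches_finsum) auto
  then obtain g h where gh: "g \<in> carrier R" "h \<in> carrier R"
    "(\<Oplus>p\<in>{..<3}. \<Oplus>q\<in>{..<3}. y p \<otimes> d p q \<otimes> w q) = g \<otimes> a \<otimes> h"
    by (auto simp: sandwiches_def)
  have "x i \<otimes> g \<otimes> a \<otimes> (h \<otimes> z j) = (if i = j then a else \<zero>)" if "i < 3" "j < 3" for i j
  proof -
    have "x i \<otimes> g \<otimes> a \<otimes> (h \<otimes> z j) = x i \<otimes> (g \<otimes> a \<otimes> h) \<otimes> z j"
      using c[of i] c[of j] gh(1,2) a(1) by (simp add: mult_assoc mult_closed)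
    also have "\<dots> = d i j" using eq[OF that] unfolding gh(3) .
    finally show ?thesis by (simp add: d_def)
  qed
  moreover have "(\<lambda>i. x i \<otimes> g) \<in> {1, 2} \<rightarrow> carrier R" "(\<lambda>j. h \<otimes> z j) \<in> {1, 2} \<rightarrow> carrier R"
    using c gh by (auto simp: mult_closed)
  ultimately show ?thesis
    unfolding properly_infinite_def using a
    by (intro conjI exI[of _ "\<lambda>i. x i \<otimes> g"] exI[of _ "\<lambda>j. h \<otimes> z j"] ballI) auto
qed

end

section \<open>Matrices\<close>

lemma matrix_ring_simps [simp]:
  "carrier (matrix_ring R n) = {A \<in> carrier_mat n n. \<forall>i<n. \<forall>j<n. A $$ (i, j) \<in> carrier R}"
  "mult (matrix_ring R n) = (\<lambda>A B. mat n n (\<lambda>(i, j). \<Oplus>\<^bsub>R\<^esub>k\<in>{..<n}. A $$ (i, k) \<otimes>\<^bsub>R\<^esub> B $$ (k, j)))"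
  "zero (matrix_ring R n) = mat n n (\<lambda>(i, j). \<zero>\<^bsub>R\<^esub>)"
  by (simp_all add: matrix_ring_def)

lemma (in nonunital_ring) rank_one_sandwich:
  assumes A: "A \<in> carrier (matrix_ring R n)"
    and c: "\<And>i. {x i, y i, w i, z i} \<subseteq> carrier R"
  shows "mat n n (\<lambda>(i, j). x i \<otimes> y j) \<otimes>\<^bsub>matrix_ring R n\<^esub> A \<otimes>\<^bsub>matrix_ring R n\<^esub>
      mat n n (\<lambda>(i, j). w i \<otimes> z j) =
    mat n n (\<lambda>(i, j). x i \<otimes> (\<Oplus>p\<in>{..<n}. \<Oplus>q\<in>{..<n}. y p \<otimes> A $$ (p, q) \<otimes> w q) \<otimes> z j)"
proof -
  have a: "A $$ (p, q) \<in> carrier R" if "p < n" "q < n" for p q using A that by simp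
  have c: "x i \<in> carrier R" "y i \<in> carrier R" "w i \<in> carrier R" "z i \<in> carrier R" for i
    using c[of i] by auto
  have sums: "(\<Oplus>q\<in>{..<n}. (\<Oplus>p\<in>{..<n}. x i \<otimes> y p \<otimes> A $$ (p, q)) \<otimes> (w q \<otimes> z j)) =
      x i \<otimes> (\<Oplus>p\<in>{..<n}. \<Oplus>q\<in>{..<n}. y p \<otimes> A $$ (p, q) \<otimes> w q) \<otimes> z j" for i j
  proof -
    have "(\<Oplus>q\<in>{..<n}. (\<Oplus>p\<in>{..<n}. x i \<otimes> y p \<otimes> A $$ (p, q)) \<otimes> (w q \<otimes> z j)) =
      (\<Oplus>q\<in>{..<n}. \<Oplus>p\<in>{..<n}. x i \<otimes> (y p \<otimes> A $$ (p, q) \<otimes> w q) \<otimes> z j)"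
      using c a by (intro finsum_cong')
        (auto simp: finsum_right_mult mult_closed mult_assoc Pi_def intro!: finsum_closed finsum_cong')
    also have "\<dots> = (\<Oplus>p\<in>{..<n}. \<Oplus>q\<in>{..<n}. x i \<otimes> (y p \<otimes> A $$ (p, q) \<otimes> w q) \<otimes> z j)"
      using c a by (intro finsum_swap) (auto simp: mult_closed)
    also have "\<dots> = (\<Oplus>p\<in>{..<n}. x i \<otimes> (\<Oplus>q\<in>{..<n}. y p \<otimes> A $$ (p, q) \<otimes> w q) \<otimes> z j)"
      using c a by (intro finsum_cong')
        (simp_all add: finsum_left_mult finsum_right_mult mult_closed finsum_closed Pi_def)
    also have "\<dots> = x i \<otimes> (\<Oplus>p\<in>{..<n}. \<Oplus>q\<in>{..<n}. y p \<otimes> A $$ (p, q) \<otimes> w q) \<otimes> z j"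
      using c a by (simp add: finsum_left_mult finsum_right_mult mult_closed finsum_closed Pi_def)
    finally show ?thesis .
  qed
  let ?X = "mat n n (\<lambda>(i, j). x i \<otimes> y j)" and ?Z = "mat n n (\<lambda>(i, j). w i \<otimes> z j)"
  have entry: "(\<Oplus>q\<in>{..<n}. mat n n (\<lambda>(i, j). \<Oplus>p\<in>{..<n}. ?X $$ (i, p) \<otimes> A $$ (p, j)) $$ (i, q) \<otimes> ?Z $$ (q, j)) =
      (\<Oplus>q\<in>{..<n}. (\<Oplus>p\<in>{..<n}. x i \<otimes> y p \<otimes> A $$ (p, q)) \<otimes> (w q \<otimes> z j))"
    if ij: "i < n" "j < n" for i j
  proof (rule finsum_cong')
    fix q assume "q \<in> {..<n}"
    moreover have "(\<Oplus>p\<in>{..<n}. ?X $$ (i, p) \<otimes> A $$ (p, q)) = (\<Oplus>p\<in>{..<n}. x i \<otimes> y p \<otimes> A $$ (p, q))"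
      if "q < n" for q
      using ij that c a by (intro finsum_cong') (auto simp: mult_closed)
    ultimately show "mat n n (\<lambda>(i, j). \<Oplus>p\<in>{..<n}. ?X $$ (i, p) \<otimes> A $$ (p, j)) $$ (i, q) \<otimes> ?Z $$ (q, j) =
        (\<Oplus>p\<in>{..<n}. x i \<otimes> y p \<otimes> A $$ (p, q)) \<otimes> (w q \<otimes> z j)"
      using ij by simp
  qed (use c a in \<open>auto intro!: finsum_closed simp: mult_closed\<close>)
  show ?thesis
  proof (rule eq_matI)
    fix i j assume "i < dim_row (mat n n (\<lambda>(i, j). x i \<otimes> (\<Oplus>p\<in>{..<n}. \<Oplus>q\<in>{..<n}. y p \<otimes> A $$ (p, q) \<otimes> w q) \<otimes> z j))"
      and "j < dim_col (mat n n (\<lambda>(i, j). x i \<otimes> (\<Oplus>p\<in>{..<n}. \<Oplus>q\<in>{..<n}. y p \<otimes> A $$ (p, q) \<otimes> w q) \<otimes> z j))"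
    then have "i < n" "j < n" by auto
    then show "(?X \<otimes>\<^bsub>matrix_ring R n\<^esub> A \<otimes>\<^bsub>matrix_ring R n\<^esub> ?Z) $$ (i, j) =
        mat n n (\<lambda>(i, j). x i \<otimes> (\<Oplus>p\<in>{..<n}. \<Oplus>q\<in>{..<n}. y p \<otimes> A $$ (p, q) \<otimes> w q) \<otimes> z j) $$ (i, j)"
      using entry[of i j] unfolding sums by simp
  qed auto
qed

context purely_infinite_exchange_ring
begin

lemma nonzero_matrix_properly_infinite:
  assumes A: "A \<in> carrier (matrix_ring R n)" "A \<noteq> \<zero>\<^bsub>matrix_ring R n\<^esub>"
  shows "properly_infinite (matrix_ring R n) A"
proof -
  have a: "A $$ (p, q) \<in> carrier R" if "p < n" "q < n" for p q using A that by simp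
  obtain i0 j0 where nz: "i0 < n" "j0 < n" "A $$ (i0, j0) \<noteq> \<zero>"
  proof (rule ccontr)
    assume "\<not> thesis"
    then have "A = \<zero>\<^bsub>matrix_ring R n\<^esub>" using A(1) that by (intro eq_matI) auto
    then show False using A(2) by simp
  qed
  obtain x y w z :: "nat \<Rightarrow> 'a" where c: "\<And>i. {x i, y i, w i, z i} \<subseteq> carrier R"
    and eq: "\<And>i j. i < n \<Longrightarrow> j < n \<Longrightarrow>
       x i \<otimes> (\<Oplus>p\<in>{..<n}. \<Oplus>q\<in>{..<n}. y p \<otimes> A $$ (p, q) \<otimes> w q) \<otimes> z j = A $$ (i, j)"
    using compress_array[of n "\<lambda>i j. A $$ (i, j)"] a by blast
  have c': "x i \<in> carrier R" "y i \<in> carrier R" "w i \<in> carrier R" "z i \<in> carrier R" for i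
    using c[of i] by auto
  define b where "b = (\<Oplus>p\<in>{..<n}. \<Oplus>q\<in>{..<n}. y p \<otimes> A $$ (p, q) \<otimes> w q)"
  have b: "b \<in> carrier R"
    unfolding b_def using c' a by (auto intro!: finsum_closed simp: mult_closed)
  have "b \<noteq> \<zero>"
    using eq[OF nz(1,2)] nz(3) c' by (auto simp: b_def[symmetric] mult_zero zero_mult)
  then obtain \<alpha> \<beta> where ab: "\<alpha> \<in> {1, 2::nat} \<rightarrow> carrier R" "\<beta> \<in> {1, 2::nat} \<rightarrow> carrier R"
    "\<forall>k\<in>{1, 2}. \<forall>l\<in>{1, 2}. \<alpha> k \<otimes> b \<otimes> \<beta> l = (if k = l then b else \<zero>)"
    using nonzero_properly_infinite[OF b] unfolding properly_infinite_def by blast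
  \<comment> \<open>With the columns \<open>x \<alpha>\<close>, \<open>w\<close> and the rows \<open>y\<close>, \<open>\<beta> z\<close>, the matrix \<open>A\<close> enters the product only through \<open>b\<close>.\<close>
  define \<alpha>' where "\<alpha>' k = mat n n (\<lambda>(i, j). (x i \<otimes> \<alpha> k) \<otimes> y j)" for k :: nat
  define \<beta>' where "\<beta>' l = mat n n (\<lambda>(i, j). w i \<otimes> (\<beta> l \<otimes> z j))" for l :: nat
  have "\<alpha>' k \<otimes>\<^bsub>matrix_ring R n\<^esub> A \<otimes>\<^bsub>matrix_ring R n\<^esub> \<beta>' l =
      (if k = l then A else \<zero>\<^bsub>matrix_ring R n\<^esub>)" if kl: "k \<in> {1, 2}" "l \<in> {1, 2}" for k l
  proof -
    have carr: "\<alpha> k \<in> carrier R" "\<beta> l \<in> carrier R" using ab kl by (auto simp: Pi_iff)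
    have "\<alpha>' k \<otimes>\<^bsub>matrix_ring R n\<^esub> A \<otimes>\<^bsub>matrix_ring R n\<^esub> \<beta>' l =
        mat n n (\<lambda>(i, j). (x i \<otimes> \<alpha> k) \<otimes> b \<otimes> (\<beta> l \<otimes> z j))"
      unfolding \<alpha>'_def \<beta>'_def b_def using c' carr
      by (intro rank_one_sandwich A) (auto simp: mult_closed)
    also have "\<dots> = (if k = l then A else \<zero>\<^bsub>matrix_ring R n\<^esub>)"
    proof -
      have "(x i \<otimes> \<alpha> k) \<otimes> b \<otimes> (\<beta> l \<otimes> z j) = (if k = l then A $$ (i, j) else \<zero>)"
        if "i < n" "j < n" for i j
      proof -
        have "(x i \<otimes> \<alpha> k) \<otimes> b \<otimes> (\<beta> l \<otimes> z j) = x i \<otimes> (\<alpha> k \<otimes> b \<otimes> \<beta> l) \<otimes> z j"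
          using c' carr b by (simp add: mult_assoc mult_closed)
        also have "\<alpha> k \<otimes> b \<otimes> \<beta> l = (if k = l then b else \<zero>)" using ab(3) kl by blast
        finally show ?thesis
          using eq[OF that] c' by (simp add: b_def[symmetric] mult_zero zero_mult)
      qed
      then show ?thesis using A(1) by (intro eq_matI) auto
    qed
    finally show ?thesis .
  qed
  moreover have "\<alpha>' \<in> {1, 2} \<rightarrow> carrier (matrix_ring R n)" "\<beta>' \<in> {1, 2} \<rightarrow> carrier (matrix_ring R n)"
    using ab(1,2) c' by (auto simp: \<alpha>'_def \<beta>'_def Pi_iff mult_closed)
  ultimately show ?thesis
    unfolding properly_infinite_def using A by blast
qed

end

theorem theorem5p7:
  fixes R :: "('a, 'm) ring_scheme" and n :: nat
  assumes "nonunital_ring R"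
    and "s_unital R"
    and "purely_infinite R"
    and "exchange_ring R"
  shows "properly_purely_infinite (matrix_ring R n)"
proof -
  interpret purely_infinite_exchange_ring R
    using assms by (intro purely_infinite_exchange_ring.intro purely_infinite_exchange_ring_axioms.intro)
  show ?thesis
    unfolding properly_purely_infinite_def using nonzero_matrix_properly_infinite by blast
qed

end
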